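(* Let $K$ be a field, $S=K[x_1,\ldots,x_n]$, and let $J\subsetneq I$ be two monomial ideals of $S$. Let $t_{I/J}$ be the index of $I/J$. Then $\operatorname{depth}_S I/J\geq t_{I/J}$ and $\operatorname{sdepth}_S I/J\geq t_{I/J}$.
   Context: For a monomial ideal $L\subset S$, $G(L)$ denotes its minimal set of monomial generators ($G(0)=\emptyset$); $[n]=\{1,\ldots,n\}$; $\deg_{x_i}u$ is the exponent of $x_i$ in the monomial $u$. Numerical invariants of a pair of monomial ideals $J\subsetneq I$: $d_{I/J}$ is the smallest degree of an element of $G(I)$, i.e. $I$ is generated by some monomials $f_1,\ldots,f_r$ of degree $d_{I/J}$ and a set $E$ of monomials of degree $\geq d_{I/J}+1$. For $i\in[n]$ put $e_i=\max_{u\in G(I)\cup G(J)}\deg_{x_i}u$, and set $e_{I/J}=\sum_{i\in[n],\,e_i>0}(e_i-1)$. Canonical form: for a variable $x_i$, let $1\le k_1<\cdots<k_s$ be all the positive exponents with which $x_i$ occurs in the monomials of $G(I)\cup G(J)$ (that is, $k$ is among them iff $x_i^{k}\mid u$ and $x_i^{k+1}\nmid u$ for some $u\in G(I)\cup G(J)$, $k\geq 1$). The canonical form of $I/J$ with respect to $x_i$ is obtained by replacing $x_i^{k_j}$ by $x_i^{j}$ in every generator in $G(I)\cup G(J)$ in which $x_i$ occurs with exponent exactly $k_j$. Doing this successively for all variables $x_1,\ldots,x_n$ gives the canonical form $I'/J'$ of $I/J$. Index: $t_{I/J}=\max\{d_{I'/J'}-e_{I'/J'},0\}$, where $I'/J'$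 is the canonical form of $I/J$. Stanley depth: a Stanley decomposition $\mathcal D$ of the $\mathbb{Z}^n$-graded $S$-module $M=I/J$ is a finite family $(K[Z_l],u_l)_{l\in L}$, where each $u_l\in M$ is multihomogeneous and $Z_l\subset\{x_1,\ldots,x_n\}$, with $K[Z_l]\cap \operatorname{Ann}_S u_l=0$ and $M=\bigoplus_{l\in L}K[Z_l]u_l$ as a multigraded $K$-vector space. Its Stanley depth is $\operatorname{sdepth}(\mathcal D)=\min_{l\in L}|Z_l|$ (the depth of $\bigoplus_l K[Z_l]u_l$), and $\operatorname{sdepth}_S M$ is the maximum of $\operatorname{sdepth}(\mathcal D)$ over all Stanley decompositions $\mathcal D$ of $M$. The depth $\operatorname{depth}_S M$ is taken with respect to the maximal ideal $(x_1,\ldots,x_n)$. *)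

theory Defs
  imports Complex_Main "HOL-Library.Poly_Mapping" "HOL-Library.Extended_Nat"
begin

section \<open>Polynomials and monomial ideals\<close>

text \<open>
  The ring \<open>S = K[x_1, \<dots>, x_n]\<close>: the type \<open>'n\<close> of variables is finite, and its linear order
  is the numbering of the variables. A monomial is identified with its exponent vector.
\<close>

type_synonym 'n monomial = "'n \<Rightarrow>\<^sub>0 nat"
type_synonym ('n, 'k) mvpoly = "'n monomial \<Rightarrow>\<^sub>0 'k"

definition monom :: "'n monomial \<Rightarrow> ('n, 'k::field) mvpoly" where
  "monom a = Poly_Mapping.single a 1"

definition variable :: "'n \<Rightarrow> ('n, 'k::field) mvpoly" where
  "variable i = monom (Poly_Mapping.single i 1)"

definition mdeg :: "'n::finite monomial \<Rightarrow> nat" where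
  "mdeg a = (\<Sum>i\<in>UNIV. Poly_Mapping.lookup a i)"

text \<open>A commutative ring is a module over itself, and its ideals are the submodules.\<close>

interpretation ring_module: module "(*) :: 'a::comm_ring_1 \<Rightarrow> 'a \<Rightarrow> 'a"
  by unfold_locales (simp_all add: algebra_simps)

abbreviation ideal_span :: "'a::comm_ring_1 set \<Rightarrow> 'a set" where
  "ideal_span \<equiv> module.span (*)"

definition monomial_ideal :: "('n, 'k::field) mvpoly set \<Rightarrow> bool" where
  "monomial_ideal I \<longleftrightarrow> (\<exists>A. I = ideal_span (monom ` A))"

definition is_minimal_generating_set :: "('n, 'k::field) mvpoly set \<Rightarrow> 'n monomial set \<Rightarrow> bool" where
  "is_minimal_generating_set I A \<longleftrightarrow>
     ideal_span (monom ` A) = I \<and> (\<forall>B. B \<subset> A \<longrightarrow> ideal_span (monom ` B) \<noteq> I)"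

text \<open>Meaningful for monomial ideals only; existence and uniqueness are proved below.\<close>

definition min_gens :: "('n, 'k::field) mvpoly set \<Rightarrow> 'n monomial set" where
  "min_gens I = (THE A. is_minimal_generating_set I A)"

lemma monom_in_ideal_span_iff:
  "(monom b :: ('n, 'k::field) mvpoly) \<in> ideal_span (monom ` A) \<longleftrightarrow> (\<exists>a\<in>A. \<exists>c. b = a + c)"
proof
  let ?U = "{p :: ('n, 'k) mvpoly. \<forall>b\<in>Poly_Mapping.keys p. \<exists>a\<in>A. \<exists>c. b = a + c}"
  assume mem: "(monom b :: ('n, 'k) mvpoly) \<in> ideal_span (monom ` A)"
  have "ring_module.subspace ?U"
  proof (rule ring_module.subspaceI)
    show "0 \<in> ?U" by simp
  next
    fix x y assume "x \<in> ?U" "y \<in> ?U"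
    then show "x + y \<in> ?U" using keys_add[of x y] by blast
  next
    fix c x assume x: "x \<in> ?U"
    show "c * x \<in> ?U"
    proof (intro CollectI ballI)
      fix b assume "b \<in> Poly_Mapping.keys (c * x)"
      then obtain u v where uv: "b = u + v" "v \<in> Poly_Mapping.keys x"
        using keys_mult[of c x] by blast
      with x obtain a d where "a \<in> A" "v = a + d" by blast
      with uv have "b = a + (u + d)" by (simp add: add_ac)
      with \<open>a \<in> A\<close> show "\<exists>a\<in>A. \<exists>c. b = a + c" by blast
    qed
  qed
  moreover have "monom ` A \<subseteq> ?U"
    by (force simp: monom_def intro: exI[of _ 0])
  ultimately have "ideal_span (monom ` A) \<subseteq> ?U"
    by (intro ring_module.span_minimal)
  with mem have "monom b \<in> ?U" by blast
  then show "\<exists>a\<in>A. \<exists>c. b = a + c" by (simp add: monom_def)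
next
  assume "\<exists>a\<in>A. \<exists>c. b = a + c"
  then obtain a c where a: "a \<in> A" "b = a + c" by blast
  then have "monom b = (monom c :: ('n, 'k) mvpoly) * monom a"
    by (simp add: monom_def mult_single add_ac)
  with a show "(monom b :: ('n, 'k) mvpoly) \<in> ideal_span (monom ` A)"
    by (auto intro: ring_module.span_scale ring_module.span_base)
qed

lemma is_minimal_generating_set_iff:
  fixes I :: "('n::finite, 'k::field) mvpoly set"
  assumes "monomial_ideal I"
  shows "is_minimal_generating_set I A \<longleftrightarrow>
    A = {a. monom a \<in> I \<and> (\<forall>b c. monom b \<in> I \<and> a = b + c \<longrightarrow> b = a)}"
proof -
  define M where "M = {a. monom a \<in> I \<and> (\<forall>b c. monom b \<in> I \<and> a = b + c \<longrightarrow> b = a)}"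
  obtain B where B: "I = ideal_span (monom ` B)"
    using assms by (auto simp: monomial_ideal_def)
  have sub: "M \<subseteq> C" if C: "ideal_span (monom ` C) = I" for C
  proof
    fix a assume a: "a \<in> M"
    then have "(monom a :: ('n, 'k) mvpoly) \<in> ideal_span (monom ` C)"
      using C by (simp add: M_def)
    then obtain b c where bc: "b \<in> C" "a = b + c" by (auto simp: monom_in_ideal_span_iff)
    have "monom b \<in> I"
      unfolding C[symmetric] using bc by (intro ring_module.span_base imageI)
    moreover have "monom b \<in> I \<and> a = b + c \<longrightarrow> b = a" using a unfolding M_def by blast
    ultimately have "b = a" using bc(2) by blast
    then show "a \<in> C" using bc(1) by simp
  qed
  have below: "\<exists>m\<in>M. \<exists>c. a = m + c" if "monom a \<in> I" for a
    using that
  proof (induction "mdeg a" arbitrary: a rule: less_induct)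
    case less
    show ?case
    proof (cases "a \<in> M")
      case True
      then show ?thesis by (intro bexI[of _ a] exI[of _ 0]) auto
    next
      case False
      with less.prems obtain b c where bc: "monom b \<in> I" "a = b + c" "b \<noteq> a"
        by (auto simp: M_def)
      then have "c \<noteq> 0" by auto
      then obtain i where "Poly_Mapping.lookup c i \<noteq> 0"
        by (metis poly_mapping_eqI lookup_zero)
      then have "mdeg c > 0" by (auto simp: mdeg_def intro!: sum_pos2[of _ i])
      moreover have "mdeg a = mdeg b + mdeg c"
        using bc by (simp add: mdeg_def lookup_add sum.distrib)
      ultimately obtain m d where "m \<in> M" "b = m + d"
        using less.hyps[of b] bc by auto
      then have "a = m + (d + c)" using bc by (simp add: add_ac)
      with \<open>m \<in> M\<close> show ?thesis by blast
    qed
  qed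
  have gen: "ideal_span (monom ` M) = I"
  proof
    have "ring_module.subspace I" using B by simp
    then show "ideal_span (monom ` M) \<subseteq> I"
      by (intro ring_module.span_minimal) (auto simp: M_def)
    have "monom ` B \<subseteq> ideal_span (monom ` M)"
    proof (intro image_subsetI)
      fix b assume "b \<in> B"
      then have "monom b \<in> I" unfolding B by (intro ring_module.span_base imageI)
      then show "monom b \<in> ideal_span (monom ` M)"
        using below by (simp add: monom_in_ideal_span_iff)
    qed
    then show "I \<subseteq> ideal_span (monom ` M)"
      unfolding B by (intro ring_module.span_minimal) auto
  qed
  show ?thesis
    unfolding M_def[symmetric] is_minimal_generating_set_def
  proof
    assume A: "ideal_span (monom ` A) = I \<and> (\<forall>B. B \<subset> A \<longrightarrow> ideal_span (monom ` B) \<noteq> I)"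
    then have "M \<subseteq> A" using sub[of A] by simp
    moreover have "\<not> M \<subset> A" using A gen by blast
    ultimately show "A = M" by simp
  next
    assume "A = M"
    then show "ideal_span (monom ` A) = I \<and> (\<forall>B. B \<subset> A \<longrightarrow> ideal_span (monom ` B) \<noteq> I)"
      using gen sub by (metis order.strict_iff_not)
  qed
qed

lemma min_gens_eq:
  fixes I :: "('n::finite, 'k::field) mvpoly set"
  assumes "monomial_ideal I"
  shows "min_gens I = {a. monom a \<in> I \<and> (\<forall>b c. monom b \<in> I \<and> a = b + c \<longrightarrow> b = a)}"
  unfolding min_gens_def by (rule the_equality) (simp_all only: is_minimal_generating_set_iff[OF assms])


section \<open>The index of a pair of monomial ideals\<close>

text \<open>
  In what follows a pair of ideals \<open>J \<subset> I\<close> stands for the module \<open>I/J\<close>.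
\<close>

definition exponents_of :: "'n \<Rightarrow> ('n, 'k::field) mvpoly set \<Rightarrow> ('n, 'k) mvpoly set \<Rightarrow> nat set" where
  "exponents_of i I J = (\<lambda>u. Poly_Mapping.lookup u i) ` (min_gens I \<union> min_gens J)"

definition initial_degree :: "('n::finite, 'k::field) mvpoly set \<Rightarrow> ('n, 'k) mvpoly set \<Rightarrow> nat" where
  "initial_degree I J = Min (mdeg ` min_gens I)"

definition max_exponent :: "'n \<Rightarrow> ('n, 'k::field) mvpoly set \<Rightarrow> ('n, 'k) mvpoly set \<Rightarrow> nat" where
  "max_exponent i I J = Max (exponents_of i I J)"

definition excess :: "('n::finite, 'k::field) mvpoly set \<Rightarrow> ('n, 'k) mvpoly set \<Rightarrow> nat" where
  "excess I J = (\<Sum>i | max_exponent i I J > 0. max_exponent i I J - 1)"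

text \<open>
  If \<open>k_1 < \<dots> < k_s\<close> are the positive elements of \<open>E\<close>, this maps \<open>k_j\<close> to \<open>j\<close>, and \<open>0\<close> to \<open>0\<close>.
\<close>

definition exponent_rank :: "nat set \<Rightarrow> nat \<Rightarrow> nat" where
  "exponent_rank E k = card {l \<in> E. 0 < l \<and> l \<le> k}"

definition compress :: "'n \<Rightarrow> nat set \<Rightarrow> 'n monomial \<Rightarrow> 'n monomial" where
  "compress i E u = Poly_Mapping.update i (exponent_rank E (Poly_Mapping.lookup u i)) u"

definition canonical_form_wrt ::
  "'n \<Rightarrow> ('n, 'k::field) mvpoly set \<times> ('n, 'k) mvpoly set
      \<Rightarrow> ('n, 'k) mvpoly set \<times> ('n, 'k) mvpoly set" where
  "canonical_form_wrt i = (\<lambda>(I, J). let E = exponents_of i I J in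
     (ideal_span (monom ` compress i E ` min_gens I),
      ideal_span (monom ` compress i E ` min_gens J)))"

definition canonical_form ::
  "('n::{finite,linorder}, 'k::field) mvpoly set \<times> ('n, 'k) mvpoly set
      \<Rightarrow> ('n, 'k) mvpoly set \<times> ('n, 'k) mvpoly set" where
  "canonical_form = fold canonical_form_wrt (sorted_list_of_set UNIV)"

definition index :: "('n::{finite,linorder}, 'k::field) mvpoly set \<Rightarrow> ('n, 'k) mvpoly set \<Rightarrow> nat" where
  "index I J = (let (I', J') = canonical_form (I, J) in
     nat (max (int (initial_degree I' J') - int (excess I' J')) 0))"


section \<open>Depth\<close>

text \<open>
  For ideals \<open>J \<subseteq> I\<close> of a commutative ring and \<open>M = I/J\<close>, the submodule \<open>(f_1, \<dots>, f_r) M\<close>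
  of \<open>M\<close> is \<open>(J + (f_1, \<dots>, f_r) I)/J\<close>. The following is its preimage in \<open>I\<close>.
\<close>

definition multiples_in_quotient :: "'a::comm_ring_1 list \<Rightarrow> 'a set \<Rightarrow> 'a set \<Rightarrow> 'a set" where
  "multiples_in_quotient fs I J = ideal_span (J \<union> {f * g | f g. f \<in> set fs \<and> g \<in> I})"

text \<open>
  \<open>f_1, \<dots>, f_r\<close> is a regular sequence on \<open>M = I/J\<close>: each \<open>f_k\<close> is a nonzerodivisor on
  \<open>M/(f_1, \<dots>, f_(k-1)) M\<close>, and \<open>M \<noteq> (f_1, \<dots>, f_r) M\<close>.
\<close>

definition regular_sequence :: "'a::comm_ring_1 list \<Rightarrow> 'a set \<Rightarrow> 'a set \<Rightarrow> bool" where
  "regular_sequence fs I J \<longleftrightarrow>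
     (\<forall>k < length fs. \<forall>g \<in> I.
        fs ! k * g \<in> multiples_in_quotient (take k fs) I J \<longrightarrow>
        g \<in> multiples_in_quotient (take k fs) I J) \<and>
     multiples_in_quotient fs I J \<noteq> I"

definition max_ideal :: "('n, 'k::field) mvpoly set" where
  "max_ideal = ideal_span (range variable)"

definition depth :: "('n, 'k::field) mvpoly set \<Rightarrow> ('n, 'k) mvpoly set \<Rightarrow> enat" where
  "depth I J = Sup {enat (length fs) | fs. set fs \<subseteq> max_ideal \<and> regular_sequence fs I J}"


section \<open>Stanley depth\<close>

text \<open>The subring \<open>K[Z]\<close> of \<open>S\<close>.\<close>

definition polys_in :: "'n set \<Rightarrow> ('n, 'k::field) mvpoly set" where
  "polys_in Z = {p. \<forall>a \<in> Poly_Mapping.keys p. Poly_Mapping.keys a \<subseteq> Z}"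

text \<open>
  The multihomogeneous elements of \<open>I/J\<close> are the classes of the elements \<open>c x^a\<close> of \<open>I\<close>;
  a family \<open>(K[Z_l], u_l)\<close> is given by the list of the \<open>(Z_l, u_l)\<close>, with \<open>u_l\<close> such a
  representative. The last two conditions say that \<open>I/J\<close> is the sum of the subspaces
  \<open>K[Z_l] u_l\<close>, and that the sum is direct.
\<close>

definition stanley_decomposition ::
  "('n, 'k::field) mvpoly set \<Rightarrow> ('n, 'k) mvpoly set \<Rightarrow> ('n set \<times> ('n, 'k) mvpoly) list \<Rightarrow> bool" where
  "stanley_decomposition I J D \<longleftrightarrow>
     (\<forall>(Z, u) \<in> set D. u \<in> I \<and> (\<exists>a c. u = Poly_Mapping.single a c) \<and>
        (\<forall>p \<in> polys_in Z. p * u \<in> J \<longrightarrow> p = 0)) \<and>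
     (\<forall>f \<in> I. \<exists>p. (\<forall>l < length D. p l \<in> polys_in (fst (D ! l))) \<and>
        f - (\<Sum>l < length D. p l * snd (D ! l)) \<in> J) \<and>
     (\<forall>p. (\<forall>l < length D. p l \<in> polys_in (fst (D ! l))) \<and>
        (\<Sum>l < length D. p l * snd (D ! l)) \<in> J \<longrightarrow>
        (\<forall>l < length D. p l * snd (D ! l) \<in> J))"

definition sdepth_of_decomposition :: "('n set \<times> ('n, 'k) mvpoly) list \<Rightarrow> nat" where
  "sdepth_of_decomposition D = Min ((\<lambda>(Z, u). card Z) ` set D)"

definition sdepth :: "('n, 'k::field) mvpoly set \<Rightarrow> ('n, 'k) mvpoly set \<Rightarrow> nat" where
  "sdepth I J = Max {sdepth_of_decomposition D | D. stanley_decomposition I J D}"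

end

theory Submission
  imports Defs "HOL-Library.FuncSet"
begin

text \<open>
  Let \<open>M i\<close> be the largest exponent of \<open>x_i\<close> in the minimal generators of \<open>I\<close> and \<open>J\<close>. Whether
  \<open>x^a\<close> lies in \<open>I\<close>, or in \<open>J\<close>, depends only on the capped exponent vector
  \<open>c = (min (a_i) (M i))_i\<close>. Hence, as a vector space, \<open>I/J\<close> is the direct sum of the spaces
  \<open>x^c K[Z_c]\<close>, where \<open>c\<close> runs through the finitely many capped vectors with \<open>x^c\<close> in \<open>I\<close> and not
  in \<open>J\<close>, and \<open>Z_c\<close> is the set of the variables whose exponent in \<open>c\<close> is maximal. The whole
  theorem rests on the inequality \<open>t \<le> card Z_c\<close> for the index \<open>t\<close> of \<open>I/J\<close>
  (\<open>index_le_card_maxed\<close>).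

  To see the inequality, pass to the canonical form \<open>I'/J'\<close>: compressing exponents turns \<open>x^c\<close> into
  a monomial of \<open>I'\<close> with the same set of maximal exponents. Its degree is at least \<open>d\<close>, the initial
  degree of \<open>I'/J'\<close>. On the other hand, a variable that occurs in the generators of \<open>I'\<close> and \<open>J'\<close>
  with largest exponent \<open>m > 0\<close> contributes at most \<open>m - 1\<close> to this degree unless it belongs to
  \<open>Z_c\<close>, and then it contributes \<open>m\<close>. So the degree is at most \<open>e + card Z_c\<close>, with \<open>e\<close> the
  excess of \<open>I'/J'\<close>. Thus \<open>t = d - e \<le> card Z_c\<close> unless \<open>t = 0\<close>.

  The bound on the Stanley depth follows, because the spaces \<open>x^c K[Z_c]\<close> form a Stanley decomposition
  (\<open>stanley_decomposition_capped\<close>).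

  For the depth, order the vectors \<open>c\<close> by degree. If \<open>x_i\<close> is not in \<open>Z_c\<close>, then multiplication by
  \<open>x_i\<close> maps \<open>x^c\<close> into \<open>J\<close> or to a capped vector of larger degree. So \<open>I/J\<close> has a filtration
  whose factors are, up to a shift, the modules \<open>S/P\<close> with \<open>P\<close> generated by the variables outside
  \<open>Z_c\<close> (\<open>weakly_regular_by_capped_monomials\<close>). A sequence that is weakly regular on the factors of
  a filtration is weakly regular on the module (\<open>weakly_regular_extension\<close>). It remains to find
  \<open>t\<close> polynomials that, for every set \<open>Z\<close> of at least \<open>t\<close> variables, are weakly regular on the
  quotient \<open>S/P\<close> by the ideal \<open>P\<close> generated by the variables outside \<open>Z\<close>. The elementary symmetric polynomials \<open>e_t, \<dots>, e_1\<close> in all the variables have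
  this property over any field (\<open>weakly_regular_elementary_symmetric\<close>). The proof is an induction
  on \<open>t\<close> and \<open>card Z\<close>. If \<open>card Z = t\<close>, then \<open>e_t\<close> acts on \<open>S/P\<close> as the product of the variables
  in \<open>Z\<close>. It is a nonzerodivisor, and the quotient by it is filtered by the quotients by the single
  variables \<open>z\<close> in \<open>Z\<close>, which are the modules belonging to the sets \<open>Z - {z}\<close> of \<open>t - 1\<close> variables.
  If \<open>card Z > t\<close>, then the sequence is weakly regular modulo some \<open>z\<close> in \<open>Z\<close> by induction, and
  homogeneity lifts this to \<open>S/P\<close> (\<open>weakly_regular_lift\<close>).
\<close>

text \<open>
  Read for the ring as a module over itself, the module law \<open>a * (b * x) = (a * b) * x\<close> is
  associativity of multiplication in the direction opposite to that of \<open>algebra_simps\<close>;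
  used together as rewrite rules they do not terminate.
\<close>

declare ring_module.scale_scale [simp del]

section \<open>Weakly regular sequences\<close>

text \<open>
  When \<open>J \<subseteq> I\<close>, this is the preimage in \<open>I\<close> of the submodule \<open>f M\<close> of \<open>M = I/J\<close>.
\<close>

definition add_multiples :: "'a::comm_ring_1 set \<Rightarrow> 'a \<Rightarrow> 'a set \<Rightarrow> 'a set" where
  "add_multiples J f I = {j + f * g | j g. j \<in> J \<and> g \<in> I}"

text \<open>
  The recursion replaces \<open>M = I/J\<close> by \<open>M/f M\<close>, so that facts about regular sequences become
  inductions on the list. "Weakly" means that \<open>f_1 M + \<dots> + f_r M\<close> may be all of \<open>M\<close>; in
  particular zero modules may occur in filtrations.
\<close>

primrec weakly_regular :: "'a::comm_ring_1 list \<Rightarrow> 'a set \<Rightarrow> 'a set \<Rightarrow> bool" where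
  "weakly_regular [] I J \<longleftrightarrow> True"
| "weakly_regular (f # fs) I J \<longleftrightarrow>
     (\<forall>g\<in>I. f * g \<in> J \<longrightarrow> g \<in> J) \<and> weakly_regular fs I (add_multiples J f I)"

abbreviation is_ideal :: "'a::comm_ring_1 set \<Rightarrow> bool" where
  "is_ideal \<equiv> module.subspace (*)"

lemmas ideal_closed =
  ring_module.subspace_0 ring_module.subspace_add ring_module.subspace_diff
  ring_module.subspace_neg ring_module.subspace_scale

lemma ideal_mult_right: "is_ideal I \<Longrightarrow> x \<in> I \<Longrightarrow> x * c \<in> I"
  by (metis mult.commute ring_module.subspace_scale)

lemma add_multiplesI: "j \<in> J \<Longrightarrow> g \<in> I \<Longrightarrow> x = j + f * g \<Longrightarrow> x \<in> add_multiples J f I"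
  by (auto simp: add_multiples_def)

lemma add_multiplesI': "j \<in> J \<Longrightarrow> g \<in> I \<Longrightarrow> j + f * g \<in> add_multiples J f I"
  by (auto simp: add_multiples_def)

lemma add_multiplesE:
  assumes "x \<in> add_multiples J f I"
  obtains j g where "j \<in> J" "g \<in> I" "x = j + f * g"
  using assms by (auto simp: add_multiples_def)

lemma is_ideal_add_multiples:
  assumes "is_ideal I" "is_ideal J"
  shows "is_ideal (add_multiples J f I)"
proof (rule ring_module.subspaceI)
  show "0 \<in> add_multiples J f I"
    by (rule add_multiplesI[of 0 _ 0]) (simp_all add: assms ideal_closed)
next
  fix x y assume "x \<in> add_multiples J f I" "y \<in> add_multiples J f I"
  then obtain j g j' g' where *: "j \<in> J" "g \<in> I" "x = j + f * g" "j' \<in> J" "g' \<in> I" "y = j' + f * g'"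
    by (auto elim!: add_multiplesE)
  show "x + y \<in> add_multiples J f I"
    by (rule add_multiplesI[of "j + j'" _ "g + g'"])
      (simp_all add: * assms ideal_closed ring_distribs ac_simps)
next
  fix c x assume "x \<in> add_multiples J f I"
  then obtain j g where *: "j \<in> J" "g \<in> I" "x = j + f * g" by (auto elim!: add_multiplesE)
  show "c * x \<in> add_multiples J f I"
  proof (rule add_multiplesI)
    show "c * j \<in> J" "c * g \<in> I" using * assms by (auto intro: ring_module.subspace_scale)
    show "c * x = c * j + f * (c * g)" by (simp add: * algebra_simps)
  qed
qed

lemma subset_add_multiples: "is_ideal I \<Longrightarrow> J \<subseteq> add_multiples J f I"
  using add_multiplesI'[of _ J 0 I f] by (auto simp: ring_module.subspace_0)

lemma add_multiples_subset:
  "is_ideal I \<Longrightarrow> J \<subseteq> I \<Longrightarrow> add_multiples J f I \<subseteq> I"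
  by (auto elim!: add_multiplesE simp: ideal_closed)

lemma multiples_in_quotient_Nil: "is_ideal J \<Longrightarrow> multiples_in_quotient [] I J = J"
  by (simp add: multiples_in_quotient_def ring_module.span_eq_iff)

lemma multiples_in_quotient_Cons:
  assumes "is_ideal I" "is_ideal J"
  shows "multiples_in_quotient (f # fs) I J = multiples_in_quotient fs I (add_multiples J f I)"
proof -
  let ?A = "J \<union> {h * g | h g. h \<in> set (f # fs) \<and> g \<in> I}"
  let ?B = "add_multiples J f I \<union> {h * g | h g. h \<in> set fs \<and> g \<in> I}"
  have "?A \<subseteq> ?B"
  proof
    fix x assume "x \<in> ?A"
    then consider "x \<in> J" | g where "g \<in> I" "x = f * g" | h g where "h \<in> set fs" "g \<in> I" "x = h * g"
      by auto
    then show "x \<in> ?B"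
    proof cases
      case 1
      then show ?thesis using subset_add_multiples[OF assms(1)] by blast
    next
      case 2
      then show ?thesis using add_multiplesI'[of 0 J g I f] assms by (simp add: ideal_closed)
    qed blast
  qed
  then have "ideal_span ?A \<subseteq> ideal_span ?B" by (rule ring_module.span_mono)
  moreover have "?B \<subseteq> ideal_span ?A"
  proof
    fix x assume "x \<in> ?B"
    then consider j g where "j \<in> J" "g \<in> I" "x = j + f * g"
      | h g where "h \<in> set fs" "g \<in> I" "x = h * g"
      by (auto elim!: add_multiplesE)
    then show "x \<in> ideal_span ?A"
    proof cases
      case 1
      then have "j \<in> ?A" "f * g \<in> ?A" by auto
      then show ?thesis using 1 by (simp only: ring_module.span_add ring_module.span_base)
    next
      case 2
      then show ?thesis by (auto intro!: ring_module.span_base)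
    qed
  qed
  then have "ideal_span ?B \<subseteq> ideal_span ?A"
    by (rule ring_module.span_minimal) simp
  ultimately show ?thesis unfolding multiples_in_quotient_def by blast
qed

lemma regular_sequence_iff:
  assumes "is_ideal I" "is_ideal J"
  shows "regular_sequence fs I J \<longleftrightarrow> weakly_regular fs I J \<and> multiples_in_quotient fs I J \<noteq> I"
proof -
  have "weakly_regular fs I J \<longleftrightarrow>
    (\<forall>k < length fs. \<forall>g \<in> I.
        fs ! k * g \<in> multiples_in_quotient (take k fs) I J \<longrightarrow>
        g \<in> multiples_in_quotient (take k fs) I J)"
    using assms(2)
  proof (induction fs arbitrary: J)
    case (Cons f fs)
    from Cons.IH[OF is_ideal_add_multiples[OF assms(1) Cons.prems]] show ?case
      by (simp add: All_less_Suc2 multiples_in_quotient_Nil[OF Cons.prems]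
          multiples_in_quotient_Cons[OF assms(1) Cons.prems])
  qed simp
  then show ?thesis by (simp add: regular_sequence_def)
qed

text \<open>
  Weak regularity depends only on the module \<open>I/J\<close>: the conditions on \<open>u\<close> say that
  multiplication by \<open>u\<close> induces an isomorphism from \<open>I/J\<close> to \<open>I'/J'\<close>. With \<open>u = 1\<close> this covers
  the second isomorphism theorem, and with a monomial \<open>u\<close> the shifts of cyclic modules.
\<close>

lemma weakly_regular_iso:
  assumes I: "is_ideal I" and J: "is_ideal J" and I': "is_ideal I'" and J': "is_ideal J'"
    and into: "\<And>x. x \<in> I \<Longrightarrow> u * x \<in> I'"
    and onto: "\<And>y. y \<in> I' \<Longrightarrow> \<exists>x\<in>I. y - u * x \<in> J'"
    and kernel: "\<And>x. x \<in> I \<Longrightarrow> u * x \<in> J' \<longleftrightarrow> x \<in> J"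
    and reg: "weakly_regular fs I J"
  shows "weakly_regular fs I' J'"
  using J J' onto kernel reg
proof (induction fs arbitrary: J J')
  case (Cons f fs)
  note J = Cons.prems(1) and J' = Cons.prems(2) and onto = Cons.prems(3) and kernel = Cons.prems(4)
  have "y \<in> J'" if y: "y \<in> I'" "f * y \<in> J'" for y
  proof -
    obtain x where x: "x \<in> I" "y - u * x \<in> J'" using onto y by blast
    have "u * (f * x) = f * y - f * (y - u * x)" by (simp add: algebra_simps)
    then have "u * (f * x) \<in> J'" using x y J' by (simp add: ideal_closed)
    then have "f * x \<in> J" using kernel x I by (simp add: ideal_closed)
    then have "x \<in> J" using Cons.prems(5) x by simp
    then have "u * x + (y - u * x) \<in> J'" using kernel x J' by (metis ring_module.subspace_add)
    then show ?thesis by simp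
  qed
  moreover have "weakly_regular fs I' (add_multiples J' f I')"
  proof (rule Cons.IH)
    show "is_ideal (add_multiples J f I)" "is_ideal (add_multiples J' f I')"
      using I I' J J' by (auto intro: is_ideal_add_multiples)
    show "\<exists>x\<in>I. y - u * x \<in> add_multiples J' f I'" if "y \<in> I'" for y
      using onto[OF that] subset_add_multiples[OF I', of J' f] by blast
    show "weakly_regular fs I (add_multiples J f I)" using Cons.prems(5) by simp
    show "u * x \<in> add_multiples J' f I' \<longleftrightarrow> x \<in> add_multiples J f I" if x: "x \<in> I" for x
    proof
      assume "u * x \<in> add_multiples J' f I'"
      then obtain j y where jy: "j \<in> J'" "y \<in> I'" "u * x = j + f * y" by (auto elim!: add_multiplesE)
      obtain w where w: "w \<in> I" "y - u * w \<in> J'" using onto jy by blast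
      have "u * (x - f * w) = j + f * (y - u * w)" using jy by (simp add: algebra_simps)
      then have "u * (x - f * w) \<in> J'" using jy w J' by (simp add: ideal_closed)
      moreover have "x - f * w \<in> I" using x w I by (simp add: ideal_closed)
      ultimately have "x - f * w \<in> J" using kernel by blast
      then show "x \<in> add_multiples J f I" by (rule add_multiplesI[OF _ w(1)]) simp
    next
      assume "x \<in> add_multiples J f I"
      then obtain j w where jw: "j \<in> J" "w \<in> I" "x = j + f * w" by (auto elim!: add_multiplesE)
      have "x - f * w \<in> I" using jw x I by (simp only: ideal_closed)
      then have "j \<in> I" using jw by simp
      then have "u * j \<in> J'" using kernel jw by blast
      then show "u * x \<in> add_multiples J' f I'"
        by (rule add_multiplesI[OF _ into[OF jw(2)]]) (simp add: jw algebra_simps)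
    qed
  qed
  ultimately show ?case by auto
qed simp

text \<open>
  For the exact sequence of \<open>N/J\<close>, \<open>I/J\<close> and \<open>I/N\<close>. As the first element \<open>f\<close> is a nonzerodivisor
  on \<open>I/N\<close>, the submodule \<open>f (I/J)\<close> meets \<open>N/J\<close> exactly in \<open>f (N/J)\<close>. So the sequence stays exact
  modulo \<open>f\<close>, and the induction proceeds.
\<close>

lemma weakly_regular_extension:
  assumes "is_ideal I" "is_ideal N" "is_ideal J" "J \<subseteq> N" "N \<subseteq> I"
    and "weakly_regular fs I N" "weakly_regular fs N J"
  shows "weakly_regular fs I J"
  using assms
proof (induction fs arbitrary: N J)
  case (Cons f fs)
  note I = Cons.prems(1) and N = Cons.prems(2) and J = Cons.prems(3)
    and JN = Cons.prems(4) and NI = Cons.prems(5)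
  let ?N = "add_multiples N f I" and ?J = "add_multiples J f I"
  have nzd: "\<forall>g\<in>I. f * g \<in> N \<longrightarrow> g \<in> N" "\<forall>g\<in>N. f * g \<in> J \<longrightarrow> g \<in> J"
    using Cons.prems by auto
  have ids: "is_ideal ?N" "is_ideal ?J" using I N J by (auto intro: is_ideal_add_multiples)
  \<comment> \<open>the second isomorphism theorem for \<open>(N + f I)/(J + f I)\<close>\<close>
  have "weakly_regular fs ?N ?J"
  proof (rule weakly_regular_iso[where u = 1 and I = N and J = "add_multiples J f N"])
    show "weakly_regular fs N (add_multiples J f N)" using Cons.prems by simp
    show "is_ideal (add_multiples J f N)" using N J by (rule is_ideal_add_multiples)
    show "1 * x \<in> ?N" if "x \<in> N" for x using subset_add_multiples[OF I, of N f] that by auto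
    show "\<exists>x\<in>N. y - 1 * x \<in> ?J" if "y \<in> ?N" for y
    proof -
      from that obtain n g where "n \<in> N" "g \<in> I" "y = n + f * g" by (auto elim!: add_multiplesE)
      then show ?thesis
        by (intro bexI[of _ n] add_multiplesI[of 0 _ g]) (auto simp: J ideal_closed)
    qed
    show "1 * x \<in> ?J \<longleftrightarrow> x \<in> add_multiples J f N" if x: "x \<in> N" for x
    proof
      assume "1 * x \<in> ?J"
      then obtain j g where jg: "j \<in> J" "g \<in> I" "x = j + f * g" by (auto elim!: add_multiplesE)
      then have "x - j \<in> N" using x JN N ring_module.subspace_diff by blast
      then have "f * g \<in> N" using jg by simp
      then have "g \<in> N" using nzd jg by blast
      then show "x \<in> add_multiples J f N" using jg by (auto intro: add_multiplesI')
    next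
      assume "x \<in> add_multiples J f N"
      then show "1 * x \<in> ?J" using NI by (auto elim!: add_multiplesE intro: add_multiplesI')
    qed
  qed (use N ids in auto)
  moreover have "weakly_regular fs I ?N" using Cons.prems by simp
  moreover have "?J \<subseteq> ?N" using JN by (auto elim!: add_multiplesE intro: add_multiplesI')
  moreover have "?N \<subseteq> I" using I NI by (rule add_multiples_subset)
  ultimately have "weakly_regular fs I ?J" using Cons.IH[OF I ids] by blast
  moreover have "\<forall>g\<in>I. f * g \<in> J \<longrightarrow> g \<in> J" using nzd JN by blast
  ultimately show ?case by simp
qed simp

lemma weakly_regular_trivial: "is_ideal I \<Longrightarrow> weakly_regular fs I I"
proof (induction fs)
  case (Cons f fs)
  have "add_multiples I f I = I"
    using add_multiples_subset[OF Cons.prems order_refl] subset_add_multiples[OF Cons.prems]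
    by (rule equalityI)
  then show ?case using Cons by simp
qed simp

lemma is_ideal_UNIV: "is_ideal UNIV"
  by (rule ring_module.subspace_UNIV)

text \<open>
  Multiplication by \<open>v z\<close> embeds the quotient by the product over \<open>Y\<close> into the quotient by the
  product over \<open>insert z Y\<close>, with cokernel the quotient by \<open>v z\<close> alone. So the quotient by a
  product of nonzerodivisors is filtered by the quotients by its factors.
\<close>

lemma weakly_regular_mod_prod:
  assumes P: "is_ideal P" and fin: "finite Y"
    and nzd: "\<And>z g. z \<in> Y \<Longrightarrow> v z * g \<in> P \<Longrightarrow> g \<in> P"
    and reg: "\<And>z. z \<in> Y \<Longrightarrow> weakly_regular fs UNIV (add_multiples P (v z) UNIV)"
  shows "weakly_regular fs UNIV (add_multiples P (prod v Y) UNIV)"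
  using fin nzd reg
proof (induction Y rule: finite_induct)
  case empty
  have "x \<in> add_multiples P 1 UNIV" for x
    by (rule add_multiplesI[of 0 _ x]) (simp_all add: P ideal_closed)
  then have "add_multiples P (prod v {}) UNIV = UNIV" by auto
  then show ?case by (simp add: weakly_regular_trivial is_ideal_UNIV)
next
  case (insert z Y)
  let ?N = "add_multiples P (v z) UNIV" and ?J = "add_multiples P (prod v (insert z Y)) UNIV"
  let ?Q = "add_multiples P (prod v Y) UNIV"
  have prod: "prod v (insert z Y) = v z * prod v Y" using insert.hyps by simp
  have ids: "is_ideal ?N" "is_ideal ?J" "is_ideal ?Q"
    using P is_ideal_UNIV by (auto intro: is_ideal_add_multiples)
  have "weakly_regular fs ?N ?J"
  proof (rule weakly_regular_iso[where u = "v z" and I = UNIV and J = ?Q])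
    show "weakly_regular fs UNIV ?Q" by (rule insert.IH) (use insert.prems in auto)
    show "v z * x \<in> ?N" for x
      by (rule add_multiplesI[of 0 _ x]) (simp_all add: P ideal_closed)
    show "\<exists>x\<in>UNIV. y - v z * x \<in> ?J" if "y \<in> ?N" for y
    proof -
      from that obtain p g where "p \<in> P" "y = p + v z * g" by (auto elim!: add_multiplesE)
      then show ?thesis by (intro bexI[of _ g] add_multiplesI[of p _ 0]) auto
    qed
    show "v z * x \<in> ?J \<longleftrightarrow> x \<in> ?Q" for x
    proof
      assume "v z * x \<in> ?J"
      then obtain p g where pg: "p \<in> P" "v z * x = p + v z * prod v Y * g"
        unfolding prod by (auto elim!: add_multiplesE)
      then have "v z * (x - prod v Y * g) \<in> P" by (simp add: algebra_simps)
      then have "x - prod v Y * g \<in> P" using insert.prems(1)[of z] by simp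
      then show "x \<in> ?Q" by (rule add_multiplesI[of _ _ g]) auto
    next
      assume "x \<in> ?Q"
      then obtain p g where pg: "p \<in> P" "x = p + prod v Y * g" by (auto elim!: add_multiplesE)
      show "v z * x \<in> ?J"
        unfolding prod
      proof (rule add_multiplesI)
        show "v z * p \<in> P" using pg P by (simp add: ideal_closed)
        show "v z * x = v z * p + v z * prod v Y * g" using pg by (simp add: algebra_simps)
      qed simp
    qed
  qed (use ids is_ideal_UNIV in auto)
  moreover have "?J \<subseteq> ?N"
  proof
    fix x assume "x \<in> ?J"
    then obtain p g where "p \<in> P" "x = p + v z * prod v Y * g"
      unfolding prod by (auto elim!: add_multiplesE)
    then show "x \<in> ?N" by (intro add_multiplesI[of p _ "prod v Y * g"]) (auto simp: mult.assoc)
  qed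
  moreover have "weakly_regular fs UNIV ?N" using insert.prems by simp
  ultimately show ?case
    using weakly_regular_extension[OF is_ideal_UNIV ids(1,2)] by blast
qed

section \<open>Homogeneous ideals\<close>

definition homogeneous :: "nat \<Rightarrow> ('n::finite, 'k::field) mvpoly \<Rightarrow> bool" where
  "homogeneous d f \<longleftrightarrow> (\<forall>a \<in> Poly_Mapping.keys f. mdeg a = d)"

text \<open>
  The polynomial \<open>q\<close> is the part of \<open>p\<close> of degree at most \<open>D\<close>. Being closed under these truncations
  characterises homogeneous ideals, and is the form in which homogeneity enters below.
\<close>

definition truncates :: "nat \<Rightarrow> ('n::finite, 'k::field) mvpoly \<Rightarrow> ('n, 'k) mvpoly \<Rightarrow> bool" where
  "truncates D q p \<longleftrightarrow>
     (\<forall>a \<in> Poly_Mapping.keys q. mdeg a \<le> D) \<and> (\<forall>a \<in> Poly_Mapping.keys (p - q). D < mdeg a)"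

definition homogeneous_ideal :: "('n::finite, 'k::field) mvpoly set \<Rightarrow> bool" where
  "homogeneous_ideal J \<longleftrightarrow> (\<forall>p\<in>J. \<forall>D. \<exists>q\<in>J. truncates D q p)"

lemma mdeg_add: "mdeg (a + b) = mdeg a + mdeg b"
  by (simp add: mdeg_def lookup_add sum.distrib)

lemma keys_addE: "a \<in> Poly_Mapping.keys (p + q) \<Longrightarrow> a \<in> Poly_Mapping.keys p \<or> a \<in> Poly_Mapping.keys q"
  using keys_add[of p q] by blast

lemma keys_multE:
  assumes "a \<in> Poly_Mapping.keys (p * q)"
  obtains b c where "b \<in> Poly_Mapping.keys p" "c \<in> Poly_Mapping.keys q" "a = b + c"
  using assms keys_mult[of p q] by blast

lemma truncates_exists: "\<exists>q. truncates D q p"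
proof -
  define q where "q = Poly_Mapping.Abs_poly_mapping (\<lambda>a. Poly_Mapping.lookup p a when mdeg a \<le> D)"
  have "finite {a. (Poly_Mapping.lookup p a when mdeg a \<le> D) \<noteq> 0}"
    by (rule finite_subset[OF _ finite_keys[of p]]) (auto simp: in_keys_iff)
  then have "Poly_Mapping.lookup q a = (Poly_Mapping.lookup p a when mdeg a \<le> D)" for a
    by (simp add: q_def)
  then have "truncates D q p"
    by (auto simp: truncates_def in_keys_iff lookup_minus when_def not_le[symmetric]
        split: if_splits)
  then show ?thesis ..
qed

lemma truncates_mult:
  assumes f: "homogeneous d f" and q: "truncates D q p"
  shows "truncates (D + d) (f * q) (f * p)"
proof -
  have "f * p - f * q = f * (p - q)" by (simp add: algebra_simps)
  then show ?thesis
    using f q by (auto simp: truncates_def homogeneous_def mdeg_add elim!: keys_multE)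
qed

lemma truncates_add:
  assumes "truncates D q p" "truncates D q' p'"
  shows "truncates D (q + q') (p + p')"
proof -
  have "p + p' - (q + q') = (p - q) + (p' - q')" by simp
  then show ?thesis using assms unfolding truncates_def by (metis keys_addE)
qed

lemma homogeneous_ideal_add_multiples:
  assumes J: "homogeneous_ideal J" and f: "homogeneous d f"
  shows "homogeneous_ideal (add_multiples J f UNIV)"
  unfolding homogeneous_ideal_def
proof (intro ballI allI)
  fix p D assume "p \<in> add_multiples J f UNIV"
  then obtain j g where p: "j \<in> J" "p = j + f * g" by (auto elim!: add_multiplesE)
  obtain q where q: "q \<in> J" "truncates D q j" using J p by (auto simp: homogeneous_ideal_def)
  have "\<exists>h. truncates D (f * h) (f * g)"
  proof (cases "d \<le> D")
    case True
    then show ?thesis using truncates_exists[of "D - d" g] truncates_mult[OF f] by fastforce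
  next
    case False
    then have "truncates D (f * 0) (f * g)"
      using f by (auto simp: truncates_def homogeneous_def mdeg_add elim!: keys_multE)
    then show ?thesis ..
  qed
  then obtain h where "truncates D (f * h) (f * g)" ..
  then have "truncates D (q + f * h) p" using truncates_add[OF q(2)] p(2) by simp
  then show "\<exists>q\<in>add_multiples J f UNIV. truncates D q p"
    using add_multiplesI'[OF q(1)] by blast
qed

lemma homogeneous_mult: "homogeneous d f \<Longrightarrow> homogeneous e g \<Longrightarrow> homogeneous (d + e) (f * g)"
  by (auto simp: homogeneous_def mdeg_add elim!: keys_multE)

lemma homogeneous_power: "homogeneous d f \<Longrightarrow> homogeneous (d * n) (f ^ n)"
proof (induction n)
  case 0
  then show ?case by (simp add: homogeneous_def mdeg_def)
next
  case (Suc n)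
  then show ?case using homogeneous_mult[of d f "d * n" "f ^ n"] by simp
qed

text \<open>
  A case of Krull's intersection theorem that degrees prove: for \<open>n\<close> larger than the degree of \<open>g\<close>,
  a representation \<open>g = j + z ^ n * r\<close> shows that \<open>g\<close> is a truncation of \<open>j\<close>.
\<close>

lemma homogeneous_ideal_separated:
  assumes J: "is_ideal J" "homogeneous_ideal J" and z: "homogeneous d z" "0 < d"
    and g: "\<And>n. g \<in> add_multiples J (z ^ n) UNIV"
  shows "g \<in> J"
proof -
  define D where "D = Max (insert 0 (mdeg ` Poly_Mapping.keys g))"
  have D: "mdeg a \<le> D" if "a \<in> Poly_Mapping.keys g" for a
    unfolding D_def using that by (intro Max_ge) auto
  obtain p r where p: "p \<in> J" "g = p + z ^ Suc D * r" using g by (blast elim!: add_multiplesE)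
  obtain q where q: "q \<in> J" "truncates D q p" using J p by (auto simp: homogeneous_ideal_def)
  have zr: "D < mdeg a" if a: "a \<in> Poly_Mapping.keys (z ^ Suc D * r)" for a
  proof -
    obtain b c where "b \<in> Poly_Mapping.keys (z ^ Suc D)" "a = b + c"
      using a by (blast elim!: keys_multE)
    then have "mdeg a = d * Suc D + mdeg c"
      using homogeneous_power[OF z(1), of "Suc D"] by (simp add: homogeneous_def mdeg_add)
    moreover have "1 * Suc D \<le> d * Suc D" using z(2) by (intro mult_right_mono) auto
    ultimately have "Suc D \<le> mdeg a" by (simp only: mult_1 trans_le_add1)
    then show ?thesis by simp
  qed
  have "Poly_Mapping.keys (g - q) = {}"
  proof (rule ccontr)
    assume "Poly_Mapping.keys (g - q) \<noteq> {}"
    then obtain a where a: "a \<in> Poly_Mapping.keys (g - q)" by blast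
    \<comment> \<open>the two descriptions of \<open>g - q\<close> confine its monomials to opposite sides of degree \<open>D\<close>\<close>
    have "g - q = (p - q) + z ^ Suc D * r" using p by simp
    then have "D < mdeg a" using a q zr unfolding truncates_def by (metis keys_addE)
    moreover have "mdeg a \<le> D"
      using keys_diff[of g q] a q D by (auto simp: truncates_def)
    ultimately show False by simp
  qed
  then show ?thesis using q by simp
qed

text \<open>
  By assumption \<open>z, f_1, \<dots>, f_r\<close> is weakly regular on \<open>S/J\<close>; here \<open>z\<close> is moved to the end and
  dropped. If \<open>f_1\<close> annihilates \<open>g\<close> modulo \<open>J\<close>, then \<open>g\<close> is divisible by every power of \<open>z\<close> modulo
  \<open>J\<close>, hence zero. Next, \<open>z\<close> is again a nonzerodivisor modulo \<open>f_1\<close>, and the induction applies to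
  the rest of the list.
\<close>

lemma weakly_regular_lift:
  assumes "is_ideal J" "homogeneous_ideal J" and z: "homogeneous d z" "0 < d"
    and "\<And>g. z * g \<in> J \<Longrightarrow> g \<in> J"
    and "\<And>f. f \<in> set fs \<Longrightarrow> \<exists>e. homogeneous e f"
    and "weakly_regular fs UNIV (add_multiples J z UNIV)"
  shows "weakly_regular fs UNIV J"
  using assms(1,2,5-)
proof (induction fs arbitrary: J)
  case (Cons f fs)
  note J = Cons.prems(1,2) and nzd = Cons.prems(3)
  have nzd': "g \<in> add_multiples J z UNIV" if "f * g \<in> add_multiples J z UNIV" for g
    using Cons.prems(5) that by auto
  have pow: "r \<in> J" if "z ^ n * r \<in> J" for n r
    using that by (induction n) (auto intro: nzd simp: mult.assoc)
  have "g \<in> J" if g: "f * g \<in> J" for g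
  proof (rule homogeneous_ideal_separated[OF J z])
    show "g \<in> add_multiples J (z ^ n) UNIV" for n
    proof (induction n)
      case 0
      show ?case by (rule add_multiplesI[of 0 _ g]) (simp_all add: J ideal_closed)
    next
      case (Suc n)
      then obtain j r where r: "j \<in> J" "g = j + z ^ n * r" by (auto elim!: add_multiplesE)
      have "z ^ n * (f * r) = f * g - f * j" using r by (simp add: algebra_simps)
      then have "z ^ n * (f * r) \<in> J" using r g J by (simp add: ideal_closed)
      then have "f * r \<in> J" by (rule pow)
      then have "r \<in> add_multiples J z UNIV"
        using nzd' subset_add_multiples[OF is_ideal_UNIV] by blast
      then obtain j' r' where r': "j' \<in> J" "r = j' + z * r'" by (auto elim!: add_multiplesE)
      show ?case
      proof (rule add_multiplesI)
        show "j + z ^ n * j' \<in> J" using r r' J by (simp add: ideal_closed)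
        show "g = j + z ^ n * j' + z ^ Suc n * r'" using r r' by (simp add: algebra_simps)
      qed simp
    qed
  qed
  moreover have "weakly_regular fs UNIV (add_multiples J f UNIV)"
  proof (rule Cons.IH)
    show "is_ideal (add_multiples J f UNIV)"
      using J is_ideal_UNIV by (auto intro: is_ideal_add_multiples)
    show "homogeneous_ideal (add_multiples J f UNIV)"
      using Cons.prems(4)[of f] J homogeneous_ideal_add_multiples by auto
    show "\<exists>e. homogeneous e f" if "f \<in> set fs" for f
      using Cons.prems(4) that by simp
    show "g \<in> add_multiples J f UNIV" if "z * g \<in> add_multiples J f UNIV" for g
    proof -
      from that obtain j h where h: "j \<in> J" "z * g = j + f * h" by (auto elim!: add_multiplesE)
      have "- j + z * g \<in> add_multiples J z UNIV"
        using h J by (intro add_multiplesI') (simp_all add: ideal_closed)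
      then have "f * h \<in> add_multiples J z UNIV" using h by simp
      then obtain j' h' where h': "j' \<in> J" "h = j' + z * h'"
        using add_multiplesE[OF nzd'] by metis
      have "z * (g - f * h') = j + f * j'" using h h' by (simp add: algebra_simps)
      then have "z * (g - f * h') \<in> J" using h h' J by (simp add: ideal_closed)
      then have "g - f * h' \<in> J" by (rule nzd)
      then show ?thesis by (rule add_multiplesI[of _ _ h']) auto
    qed
    have "add_multiples (add_multiples J f UNIV) z UNIV = add_multiples (add_multiples J z UNIV) f UNIV"
      unfolding add_multiples_def by (auto simp: add_ac) (metis add.assoc add.commute)+
    then show "weakly_regular fs UNIV (add_multiples (add_multiples J f UNIV) z UNIV)"
      using Cons.prems(5) by simp
  qed
  ultimately show ?case by simp
qed simp


section \<open>Monomials\<close>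

lemma poly_expansion:
  fixes p :: "('n, 'k::field) mvpoly"
  shows "(\<Sum>a\<in>Poly_Mapping.keys p. Poly_Mapping.single a (Poly_Mapping.lookup p a)) = p"
  by (rule poly_mapping_eqI) (simp add: lookup_sum lookup_single when_def in_keys_iff)

lemma lookup_single_mult:
  fixes p :: "('n, 'k::field) mvpoly"
  shows "Poly_Mapping.lookup (Poly_Mapping.single u v * p) (u + b) = v * Poly_Mapping.lookup p b"
proof -
  have "Poly_Mapping.single u v * p =
      (\<Sum>a\<in>Poly_Mapping.keys p. Poly_Mapping.single (u + a) (v * Poly_Mapping.lookup p a))"
    by (subst poly_expansion[of p, symmetric]) (simp only: sum_distrib_left mult_single)
  then show ?thesis
    by (simp add: lookup_sum lookup_single when_def in_keys_iff)
qed

lemma keys_monom_mult: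
  fixes p :: "('n, 'k::field) mvpoly"
  shows "Poly_Mapping.keys (monom u * p) = (+) u ` Poly_Mapping.keys p"
proof
  show "Poly_Mapping.keys (monom u * p) \<subseteq> (+) u ` Poly_Mapping.keys p"
    by (auto simp: monom_def elim!: keys_multE split: if_splits)
  show "(+) u ` Poly_Mapping.keys p \<subseteq> Poly_Mapping.keys (monom u * p)"
    by (auto simp: monom_def in_keys_iff lookup_single_mult)
qed

lemma keys_monom [simp]: "Poly_Mapping.keys (monom a :: ('n, 'k::field) mvpoly) = {a}"
  by (simp add: monom_def)

lemma single_eq_scaled_monom: "Poly_Mapping.single a c = Poly_Mapping.single 0 c * monom a"
  by (simp add: monom_def mult_single)

lemma multiple_iff:
  fixes u a :: "'n monomial"
  shows "(\<exists>c. a = u + c) \<longleftrightarrow> (\<forall>i. Poly_Mapping.lookup u i \<le> Poly_Mapping.lookup a i)"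
proof
  assume "\<forall>i. Poly_Mapping.lookup u i \<le> Poly_Mapping.lookup a i"
  then have "a = u + (a - u)" by (intro poly_mapping_eqI) (simp add: lookup_add lookup_minus)
  then show "\<exists>c. a = u + c" ..
qed (auto simp: lookup_add)

lemma is_ideal_monomial_ideal: "monomial_ideal I \<Longrightarrow> is_ideal I"
  by (auto simp: monomial_ideal_def)

text \<open>
  Monomial ideals are determined by their monomials, so that all questions about them below become
  questions about exponent vectors.
\<close>

lemma in_monomial_ideal_iff:
  fixes I :: "('n, 'k::field) mvpoly set"
  assumes "monomial_ideal I"
  shows "p \<in> I \<longleftrightarrow> (\<forall>a \<in> Poly_Mapping.keys p. monom a \<in> I)"
proof
  obtain A where A: "I = ideal_span (monom ` A)" using assms by (auto simp: monomial_ideal_def)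
  note I = is_ideal_monomial_ideal[OF assms]
  {
    assume "p \<in> I"
    let ?U = "{p :: ('n, 'k) mvpoly. \<forall>a \<in> Poly_Mapping.keys p. monom a \<in> I}"
    have "is_ideal ?U"
    proof (rule ring_module.subspaceI)
      fix c x assume x: "x \<in> ?U"
      show "c * x \<in> ?U"
      proof (intro CollectI ballI)
        fix a assume "a \<in> Poly_Mapping.keys (c * x)"
        then obtain u v where uv: "a = u + v" "v \<in> Poly_Mapping.keys x" by (auto elim!: keys_multE)
        then have "monom v \<in> I" using x by blast
        then have "monom u * monom v \<in> I" by (rule ring_module.subspace_scale[OF I])
        then show "monom a \<in> I" by (simp add: uv monom_def mult_single)
      qed
    qed (auto dest!: keys_addE)
    moreover have "monom ` A \<subseteq> ?U" by (auto simp: A ring_module.span_base)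
    ultimately have "I \<subseteq> ?U" unfolding A by (intro ring_module.span_minimal)
    with \<open>p \<in> I\<close> show "\<forall>a \<in> Poly_Mapping.keys p. monom a \<in> I" by blast
  next
    assume "\<forall>a \<in> Poly_Mapping.keys p. monom a \<in> I"
    then have "Poly_Mapping.single a (Poly_Mapping.lookup p a) \<in> I"
      if "a \<in> Poly_Mapping.keys p" for a
      using that I by (subst single_eq_scaled_monom) (auto intro: ring_module.subspace_scale)
    then have "(\<Sum>a\<in>Poly_Mapping.keys p. Poly_Mapping.single a (Poly_Mapping.lookup p a)) \<in> I"
      by (rule ring_module.subspace_sum[OF I])
    then show "p \<in> I" by (simp only: poly_expansion)
  }
qed

lemma monom_in_monomial_ideal_mono:
  assumes "monomial_ideal I" "monom u \<in> I"
    and "\<And>i. Poly_Mapping.lookup u i \<le> Poly_Mapping.lookup a i"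
  shows "monom a \<in> I"
proof -
  obtain c where "a = u + c" using assms multiple_iff by metis
  then have "monom a = monom c * monom u" by (simp add: monom_def mult_single add.commute)
  then show ?thesis using assms is_ideal_monomial_ideal ring_module.subspace_scale by metis
qed

section \<open>Ideals generated by variables, and elementary symmetric polynomials\<close>

text \<open>
  The ideal generated by the variables outside \<open>Z\<close>, described by its monomials; the quotient by it
  is \<open>K[Z]\<close>.
\<close>

definition outside_ideal :: "'n set \<Rightarrow> ('n, 'k::field) mvpoly set" where
  "outside_ideal Z = {p. \<forall>a \<in> Poly_Mapping.keys p. \<not> Poly_Mapping.keys a \<subseteq> Z}"

lemma keys_add_monomial:
  fixes a b :: "'n monomial"
  shows "Poly_Mapping.keys (a + b) = Poly_Mapping.keys a \<union> Poly_Mapping.keys b"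
  by (auto simp: in_keys_iff lookup_add)

lemma is_ideal_outside_ideal: "is_ideal (outside_ideal Z)"
proof (rule ring_module.subspaceI)
  fix c x assume "x \<in> outside_ideal Z"
  then show "c * x \<in> outside_ideal Z"
    by (auto simp: outside_ideal_def keys_add_monomial elim!: keys_multE)
qed (auto simp: outside_ideal_def dest!: keys_addE)

lemma homogeneous_ideal_outside_ideal: "homogeneous_ideal (outside_ideal Z)"
  unfolding homogeneous_ideal_def
proof (intro ballI allI)
  fix p :: "('a, 'b) mvpoly" and D assume p: "p \<in> outside_ideal Z"
  obtain q where q: "truncates D q p" using truncates_exists by blast
  have "a \<in> Poly_Mapping.keys p" if a: "a \<in> Poly_Mapping.keys q" for a
  proof -
    have "a \<notin> Poly_Mapping.keys (p - q)" using q a by (fastforce simp: truncates_def)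
    then show ?thesis using a by (simp add: in_keys_iff lookup_minus)
  qed
  then have "q \<in> outside_ideal Z" using p by (auto simp: outside_ideal_def)
  then show "\<exists>q\<in>outside_ideal Z. truncates D q p" using q by blast
qed

lemma variable_mult_in_outside_ideal_iff:
  assumes "z \<in> Z"
  shows "variable z * p \<in> outside_ideal Z \<longleftrightarrow> p \<in> outside_ideal Z"
  using assms by (auto simp: outside_ideal_def variable_def keys_monom_mult keys_add_monomial)

lemma prod_variable_mult_in_outside_ideal_iff:
  assumes "finite Y" "Y \<subseteq> Z"
  shows "prod variable Y * p \<in> outside_ideal Z \<longleftrightarrow> p \<in> outside_ideal Z"
  using assms
  by (induction Y rule: finite_induct) (auto simp: mult.assoc variable_mult_in_outside_ideal_iff)

lemma add_multiples_variable_outside_ideal: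
  assumes "z \<in> Z"
  shows "add_multiples (outside_ideal Z) (variable z) UNIV
    = (outside_ideal (Z - {z}) :: ('n, 'k::field) mvpoly set)"
proof
  show "add_multiples (outside_ideal Z) (variable z) UNIV
      \<subseteq> (outside_ideal (Z - {z}) :: ('n, 'k) mvpoly set)"
    by (auto simp: outside_ideal_def variable_def keys_monom_mult keys_add_monomial
        elim!: add_multiplesE dest!: keys_addE)
next
  let ?Q = "add_multiples (outside_ideal Z) (variable z) UNIV :: ('n, 'k) mvpoly set"
  have Q: "is_ideal ?Q" by (intro is_ideal_add_multiples is_ideal_UNIV is_ideal_outside_ideal)
  show "outside_ideal (Z - {z}) \<subseteq> ?Q"
  proof
    fix p :: "('n, 'k) mvpoly" assume p: "p \<in> outside_ideal (Z - {z})"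
    have "Poly_Mapping.single a c \<in> ?Q" if a: "a \<in> Poly_Mapping.keys p" for a and c :: 'k
    proof (cases "Poly_Mapping.keys a \<subseteq> Z")
      case False
      then have "Poly_Mapping.single a c \<in> outside_ideal Z" by (auto simp: outside_ideal_def)
      then show ?thesis using subset_add_multiples[OF is_ideal_UNIV] by blast
    next
      case True
      then have "z \<in> Poly_Mapping.keys a" using p a by (auto simp: outside_ideal_def)
      then have "\<forall>i. Poly_Mapping.lookup (Poly_Mapping.single z 1) i \<le> Poly_Mapping.lookup a i"
        by (auto simp: lookup_single when_def in_keys_iff)
      then obtain b where "a = Poly_Mapping.single z 1 + b" using multiple_iff by blast
      then have "Poly_Mapping.single a c = 0 + variable z * Poly_Mapping.single b c"
        by (simp add: variable_def monom_def mult_single)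
      then show ?thesis
        by (rule add_multiplesI[rotated 2]) (simp_all add: is_ideal_outside_ideal ring_module.subspace_0)
    qed
    then have "(\<Sum>a\<in>Poly_Mapping.keys p. Poly_Mapping.single a (Poly_Mapping.lookup p a)) \<in> ?Q"
      by (auto intro!: ring_module.subspace_sum[OF Q])
    then show "p \<in> ?Q" by (simp only: poly_expansion)
  qed
qed

definition elementary_symmetric :: "nat \<Rightarrow> ('n::finite, 'k::field) mvpoly" where
  "elementary_symmetric k = (\<Sum>F | card F = k. prod variable F)"

lemma homogeneous_variable: "homogeneous 1 (variable i)"
  by (simp add: homogeneous_def variable_def mdeg_def lookup_single when_def)

lemma homogeneous_elementary_symmetric: "homogeneous k (elementary_symmetric k)"
proof -
  have "homogeneous (card F) (prod variable F :: ('a, 'b) mvpoly)" if "finite F" for F :: "'a set"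
    using that
  proof (induction F rule: finite_induct)
    case empty
    then show ?case by (simp add: homogeneous_def mdeg_def)
  next
    case (insert i F)
    then show ?case using homogeneous_mult[OF homogeneous_variable[of i] insert.IH] by simp
  qed
  then show ?thesis
    using keys_sum[of "prod variable" "{F. card F = k}"]
    by (fastforce simp: homogeneous_def elementary_symmetric_def)
qed

text \<open>
  Any other squarefree monomial of degree \<open>card Z\<close> contains a variable outside \<open>Z\<close>.
\<close>

lemma elementary_symmetric_mod_outside_ideal:
  fixes Z :: "'n::finite set"
  shows "(elementary_symmetric (card Z) - prod variable Z :: ('n, 'k::field) mvpoly) \<in> outside_ideal Z"
proof -
  have "(prod variable F :: ('n, 'k) mvpoly) \<in> outside_ideal Z" if F: "F \<in> {F. card F = card Z} - {Z}" for F
  proof -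
    have "\<not> F \<subseteq> Z" using F card_subset_eq[of Z F] by auto
    then obtain i where i: "i \<in> F" "i \<notin> Z" by blast
    then have "(variable i :: ('n, 'k) mvpoly) \<in> outside_ideal Z" by (simp add: outside_ideal_def variable_def)
    moreover have "(prod variable F :: ('n, 'k) mvpoly) = variable i * prod variable (F - {i})"
      using i by (simp add: prod.remove)
    ultimately show ?thesis by (metis is_ideal_outside_ideal ideal_mult_right)
  qed
  then have "(\<Sum>F\<in>{F. card F = card Z} - {Z}. prod variable F :: ('n, 'k) mvpoly) \<in> outside_ideal Z"
    by (rule ring_module.subspace_sum[OF is_ideal_outside_ideal])
  moreover have "(elementary_symmetric (card Z) - prod variable Z :: ('n, 'k) mvpoly)
      = (\<Sum>F\<in>{F. card F = card Z} - {Z}. prod variable F)"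
    by (simp add: elementary_symmetric_def sum_diff1)
  ultimately show ?thesis by simp
qed

lemma add_multiples_cong:
  assumes J: "is_ideal J" and f: "f - f' \<in> J"
  shows "add_multiples J f UNIV = add_multiples J f' UNIV"
proof -
  have *: "add_multiples J f UNIV \<subseteq> add_multiples J f' UNIV" if f: "f - f' \<in> J" for f f'
  proof
    fix x assume "x \<in> add_multiples J f UNIV"
    then obtain j g where *: "j \<in> J" "x = j + f * g" by (auto elim!: add_multiplesE)
    show "x \<in> add_multiples J f' UNIV"
    proof (rule add_multiplesI)
      show "j + (f - f') * g \<in> J" using * f J by (simp add: ideal_closed ideal_mult_right)
      show "x = j + (f - f') * g + f' * g" using * by (simp add: algebra_simps)
    qed simp
  qed
  have "f' - f \<in> J" using ring_module.subspace_neg[OF J f] by simp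
  then show ?thesis using * f by blast
qed

text \<open>
  The list is \<open>e_t, \<dots>, e_1\<close>. It starts with \<open>e_t\<close> because, in the case \<open>card Z = t\<close>, this
  polynomial becomes a product of variables and leads back to sets with \<open>t - 1\<close> elements.
\<close>

lemma weakly_regular_elementary_symmetric:
  fixes Z :: "'n::finite set"
  assumes "t \<le> card Z"
  shows "weakly_regular (map elementary_symmetric (rev [1..<Suc t]))
    UNIV (outside_ideal Z :: ('n, 'k::field) mvpoly set)"
  using assms
proof (induction t arbitrary: Z)
  case (Suc t)
  let ?fs = "map elementary_symmetric (rev [1..<Suc (Suc t)]) :: ('n, 'k) mvpoly list"
  show ?case
    using Suc.prems
  proof (induction "card Z" arbitrary: Z rule: less_induct)
    case less
    show ?case
    proof (cases "card Z = Suc t")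
      case True
      let ?e = "elementary_symmetric (Suc t) :: ('n, 'k) mvpoly" and ?P = "outside_ideal Z :: ('n, 'k) mvpoly set"
      have e: "?e - prod variable Z \<in> ?P"
        using elementary_symmetric_mod_outside_ideal[of Z] True by simp
      have "g \<in> ?P" if g: "?e * g \<in> ?P" for g
      proof -
        have "?e * g - (?e - prod variable Z) * g \<in> ?P"
          by (rule ring_module.subspace_diff[OF is_ideal_outside_ideal g
                ideal_mult_right[OF is_ideal_outside_ideal e]])
        then have "prod variable Z * g \<in> ?P" by (simp add: algebra_simps)
        then show ?thesis by (simp add: prod_variable_mult_in_outside_ideal_iff)
      qed
      moreover have "weakly_regular (map elementary_symmetric (rev [1..<Suc t])) UNIV
          (add_multiples ?P (prod variable Z) UNIV)"
      proof (rule weakly_regular_mod_prod)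
        fix z assume z: "z \<in> Z"
        show "weakly_regular (map elementary_symmetric (rev [1..<Suc t])) UNIV
            (add_multiples ?P (variable z) UNIV)"
          unfolding add_multiples_variable_outside_ideal[OF z]
          using True z by (intro Suc.IH) simp
      qed (auto simp: is_ideal_outside_ideal variable_mult_in_outside_ideal_iff)
      ultimately show ?thesis
        by (simp add: add_multiples_cong[OF is_ideal_outside_ideal e])
    next
      case False
      then have card: "Suc t < card Z" using less.prems by simp
      then obtain z where z: "z \<in> Z" by fastforce
      show ?thesis
      proof (rule weakly_regular_lift)
        show "weakly_regular ?fs UNIV (add_multiples (outside_ideal Z) (variable z) UNIV)"
          unfolding add_multiples_variable_outside_ideal[OF z]
          using z card by (intro less.hyps) (auto simp: card_gt_0_iff)
        show "\<exists>e. homogeneous e f" if "f \<in> set ?fs" for f :: "('n, 'k) mvpoly"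
          using that homogeneous_elementary_symmetric by auto
      qed (use z in \<open>auto simp: is_ideal_outside_ideal homogeneous_ideal_outside_ideal
          variable_mult_in_outside_ideal_iff intro: homogeneous_variable\<close>)
    qed
  qed
qed simp


section \<open>Capping exponents\<close>

definition cap :: "('n \<Rightarrow> nat) \<Rightarrow> 'n::finite monomial \<Rightarrow> 'n monomial" where
  "cap M a = Poly_Mapping.Abs_poly_mapping (\<lambda>i. min (Poly_Mapping.lookup a i) (M i))"

text \<open>
  For a monomial that is already capped, these are the variables in which it can be multiplied
  freely without changing its capped form.
\<close>

definition maxed :: "('n \<Rightarrow> nat) \<Rightarrow> 'n monomial \<Rightarrow> 'n set" where
  "maxed M a = {i. M i \<le> Poly_Mapping.lookup a i}"

definition exponents_matter_up_to :: "('n \<Rightarrow> nat) \<Rightarrow> ('n::finite, 'k::field) mvpoly set \<Rightarrow> bool" where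
  "exponents_matter_up_to M I \<longleftrightarrow> (\<forall>a. monom (cap M a) \<in> I \<longleftrightarrow> monom a \<in> I)"

text \<open>
  The exponent vectors \<open>c\<close> that index the decomposition of \<open>I/J\<close> into the spaces \<open>x^c K[maxed M c]\<close>.
\<close>

definition capped_monomials ::
  "('n \<Rightarrow> nat) \<Rightarrow> ('n::finite, 'k::field) mvpoly set \<Rightarrow> ('n, 'k) mvpoly set \<Rightarrow> 'n monomial set" where
  "capped_monomials M I J = {c. cap M c = c \<and> monom c \<in> I \<and> monom c \<notin> J}"

lemma lookup_cap [simp]:
  "Poly_Mapping.lookup (cap M a) i = min (Poly_Mapping.lookup a i) (M i)"
  by (simp add: cap_def)

lemma cap_eq_iff: "cap M a = c \<longleftrightarrow> (\<forall>i. min (Poly_Mapping.lookup a i) (M i) = Poly_Mapping.lookup c i)"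
  by (metis lookup_cap poly_mapping_eqI)

lemma cap_cap [simp]: "cap M (cap M a) = cap M a"
  by (simp add: cap_eq_iff)

lemma cap_add_maxed:
  assumes "cap M c = c" "Poly_Mapping.keys b \<subseteq> maxed M c"
  shows "cap M (c + b) = c"
  unfolding cap_eq_iff
proof
  fix i
  have "Poly_Mapping.lookup c i \<le> M i" using assms(1) unfolding cap_eq_iff by (metis min.cobounded2)
  show "min (Poly_Mapping.lookup (c + b) i) (M i) = Poly_Mapping.lookup c i"
  proof (cases "i \<in> Poly_Mapping.keys b")
    case True
    then have "M i \<le> Poly_Mapping.lookup c i" using assms(2) by (auto simp: maxed_def)
    then show ?thesis using \<open>Poly_Mapping.lookup c i \<le> M i\<close> by (simp add: lookup_add)
  next
    case False
    then have "Poly_Mapping.lookup b i = 0" by (simp add: in_keys_iff)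
    then show ?thesis using \<open>Poly_Mapping.lookup c i \<le> M i\<close> by (simp add: lookup_add)
  qed
qed

lemma lookup_capped_monomial_le:
  assumes "c \<in> capped_monomials M I J"
  shows "Poly_Mapping.lookup c i \<le> M i"
proof -
  have "cap M c = c" using assms by (simp add: capped_monomials_def)
  then have "Poly_Mapping.lookup c i = min (Poly_Mapping.lookup c i) (M i)" by (metis lookup_cap)
  then show ?thesis by simp
qed

lemma finite_capped_monomials: "finite (capped_monomials M I J)"
proof -
  have "finite (PiE UNIV (\<lambda>i. {..M i}))" by (rule finite_PiE) auto
  moreover have "Poly_Mapping.lookup ` capped_monomials M I J \<subseteq> PiE UNIV (\<lambda>i. {..M i})"
    by (auto intro: lookup_capped_monomial_le)
  ultimately have "finite (Poly_Mapping.lookup ` capped_monomials M I J)" by (rule finite_subset[rotated])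
  then show ?thesis
    by (rule finite_imageD) (auto simp: inj_on_def intro: poly_mapping_eqI)
qed

lemma cap_in_capped_monomials:
  assumes "exponents_matter_up_to M I" "exponents_matter_up_to M J" "monom a \<in> I" "monom a \<notin> J"
  shows "cap M a \<in> capped_monomials M I J"
  using assms by (simp add: capped_monomials_def exponents_matter_up_to_def)

lemma monom_in_difference:
  fixes I J :: "('n::finite, 'k::field) mvpoly set"
  assumes I: "monomial_ideal I" and J: "monomial_ideal J" and "\<not> I \<subseteq> J"
  obtains a where "monom a \<in> I" "monom a \<notin> J"
proof -
  obtain p where "p \<in> I" "p \<notin> J" using assms by blast
  then show ?thesis
    using that in_monomial_ideal_iff[OF I, of p] in_monomial_ideal_iff[OF J, of p] by blast
qed

lemma capped_monomials_nonempty: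
  fixes I J :: "('n::finite, 'k::field) mvpoly set"
  assumes "monomial_ideal I" "monomial_ideal J" "\<not> I \<subseteq> J"
    and "exponents_matter_up_to M I" "exponents_matter_up_to M J"
  shows "capped_monomials M I J \<noteq> {}"
proof -
  obtain a where "monom a \<in> I" "monom a \<notin> J" using assms(1-3) by (rule monom_in_difference)
  then show ?thesis using cap_in_capped_monomials[OF assms(4,5)] by blast
qed

text \<open>
  Take a capped monomial \<open>x^c\<close> of \<open>I/J\<close> of the largest degree, and \<open>N = J + (x^c)\<close>. A multiple of
  \<open>x^c\<close> that is not in \<open>J\<close> has a capped form above \<open>c\<close>, which equals \<open>c\<close> by maximality. Hence the
  annihilator of \<open>x^c\<close> modulo \<open>J\<close> is generated by the variables outside \<open>maxed M c\<close>, which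
  identifies \<open>N/J\<close>; and \<open>I/N\<close> has the same capped monomials as \<open>I/J\<close> except \<open>c\<close>.
\<close>

lemma weakly_regular_by_capped_monomials:
  fixes I J :: "('n::finite, 'k::field) mvpoly set"
  assumes I: "monomial_ideal I" "exponents_matter_up_to M I"
    and "monomial_ideal J" "exponents_matter_up_to M J" "J \<subseteq> I"
    and "\<And>c. c \<in> capped_monomials M I J \<Longrightarrow> weakly_regular fs UNIV (outside_ideal (maxed M c))"
  shows "weakly_regular fs I J"
  using assms(3-)
proof (induction "card (capped_monomials M I J)" arbitrary: J rule: less_induct)
  case less
  note J = less.prems(1,2) and JI = less.prems(3) and pieces = less.prems(4)
  note ideals = is_ideal_monomial_ideal[OF I(1)] is_ideal_monomial_ideal[OF J(1)]
  let ?C = "capped_monomials M I J"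
  show ?case
  proof (cases "?C = {}")
    case True
    then have "I = J" using capped_monomials_nonempty[OF I(1) J(1) _ I(2) J(2)] JI by blast
    then show ?thesis using weakly_regular_trivial[OF ideals(1)] by simp
  next
    case False
    then have "Max (mdeg ` ?C) \<in> mdeg ` ?C"
      using finite_capped_monomials[of M I J] by (intro Max_in) auto
    then obtain c where c: "c \<in> ?C" and c_max: "mdeg c = Max (mdeg ` ?C)" by auto
    have max: "mdeg a \<le> mdeg c" if "a \<in> ?C" for a
      unfolding c_max using finite_capped_monomials[of M I J] that by (intro Max_ge) auto
    have cap_c: "cap M c = c" and cI: "monom c \<in> I" and cJ: "monom c \<notin> J"
      using c by (auto simp: capped_monomials_def)
    define N :: "('n, 'k) mvpoly set" where
      "N = ideal_span (monom ` insert c {a. (monom a :: ('n, 'k) mvpoly) \<in> J})"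
    have N: "monomial_ideal N" unfolding N_def monomial_ideal_def by blast
    have above_c: "cap M a = c \<or> monom a \<in> J" if "\<And>i. Poly_Mapping.lookup c i \<le> Poly_Mapping.lookup a i" for a
    proof (rule ccontr)
      assume *: "\<not> (cap M a = c \<or> monom a \<in> J)"
      have "monom a \<in> I" using monom_in_monomial_ideal_mono[OF I(1) cI that] .
      then have "cap M a \<in> ?C" using * cap_in_capped_monomials[OF I(2) J(2)] by blast
      then have le: "mdeg (cap M a) \<le> mdeg c" by (rule max)
      have ge: "Poly_Mapping.lookup c i \<le> Poly_Mapping.lookup (cap M a) i" for i
        using that[of i] cap_c[unfolded cap_eq_iff, rule_format, of i] by simp
      have "\<exists>i. Poly_Mapping.lookup c i < Poly_Mapping.lookup (cap M a) i"
        using * ge by (metis le_neq_implies_less poly_mapping_eqI)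
      then have "mdeg c < mdeg (cap M a)"
        unfolding mdeg_def using ge by (intro sum_strict_mono_ex1) auto
      then show False using le by simp
    qed
    have monom_N: "monom a \<in> N \<longleftrightarrow> monom a \<in> J \<or> cap M a = c" for a
    proof -
      have "monom a \<in> N \<longleftrightarrow> (\<exists>b. a = c + b) \<or> (\<exists>u b. monom u \<in> J \<and> a = u + b)"
        unfolding N_def monom_in_ideal_span_iff by blast
      also have "(\<exists>u b. (monom u :: ('n, 'k) mvpoly) \<in> J \<and> a = u + b) \<longleftrightarrow> (monom a :: ('n, 'k) mvpoly) \<in> J"
        using monom_in_monomial_ideal_mono[OF J(1)] multiple_iff by (metis add.right_neutral)
      also have "(\<exists>b. a = c + b) \<or> monom a \<in> J \<longleftrightarrow> monom a \<in> J \<or> cap M a = c"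
        unfolding multiple_iff using above_c by (metis cap_eq_iff min.cobounded1)
      finally show ?thesis .
    qed
    have JN: "J \<subseteq> N"
      using in_monomial_ideal_iff[OF J(1)] in_monomial_ideal_iff[OF N] monom_N by blast
    have NI: "N \<subseteq> I"
      using in_monomial_ideal_iff[OF I(1)] in_monomial_ideal_iff[OF N] monom_N JI cI I(2)
      unfolding exponents_matter_up_to_def by blast
    have capN: "exponents_matter_up_to M N"
      using J(2) by (simp add: exponents_matter_up_to_def monom_N)
    have "capped_monomials M I N \<subset> ?C"
      using c cap_c by (auto simp: capped_monomials_def monom_N)
    then have "weakly_regular fs I N"
      using finite_capped_monomials[of M I J]
      by (intro less.hyps N capN NI pieces) (auto intro: psubset_card_mono)
    moreover have "weakly_regular fs N J"
    proof (rule weakly_regular_iso[OF is_ideal_UNIV is_ideal_outside_ideal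
          is_ideal_monomial_ideal[OF N] ideals(2)])
      show "weakly_regular fs UNIV (outside_ideal (maxed M c))" using pieces[OF c] .
      show "monom c * x \<in> N" for x
        using in_monomial_ideal_iff[OF N] monom_N
        by (metis ideal_mult_right is_ideal_monomial_ideal[OF N] cap_c)
      show "monom c * x \<in> J \<longleftrightarrow> x \<in> outside_ideal (maxed M c)" for x
      proof -
        have "(monom (c + b) :: ('n, 'k) mvpoly) \<in> J \<longleftrightarrow> \<not> Poly_Mapping.keys b \<subseteq> maxed M c" for b
        proof
          assume "(monom (c + b) :: ('n, 'k) mvpoly) \<in> J"
          then have "cap M (c + b) \<noteq> c" using cJ J(2) unfolding exponents_matter_up_to_def by metis
          then show "\<not> Poly_Mapping.keys b \<subseteq> maxed M c" using cap_add_maxed[OF cap_c] by blast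
        next
          assume "\<not> Poly_Mapping.keys b \<subseteq> maxed M c"
          then obtain i where "i \<in> Poly_Mapping.keys b" "i \<notin> maxed M c" by blast
          then have "0 < Poly_Mapping.lookup b i" "Poly_Mapping.lookup c i < M i"
            by (auto simp: maxed_def in_keys_iff)
          then have "min (Poly_Mapping.lookup (c + b) i) (M i) \<noteq> Poly_Mapping.lookup c i"
            by (simp add: lookup_add)
          then have "cap M (c + b) \<noteq> c" unfolding cap_eq_iff by blast
          then show "(monom (c + b) :: ('n, 'k) mvpoly) \<in> J" using above_c[of "c + b"] by (simp add: lookup_add)
        qed
        then show ?thesis
          unfolding in_monomial_ideal_iff[OF J(1), of "monom c * x"]
          by (simp add: keys_monom_mult outside_ideal_def)
      qed
      show "\<exists>x\<in>UNIV. y - monom c * x \<in> J" if "y \<in> N" for y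
      proof -
        have "y \<in> add_multiples J (monom c) UNIV"
        proof -
          have *: "is_ideal (add_multiples J (monom c) UNIV)"
            by (intro is_ideal_add_multiples is_ideal_UNIV ideals)
          have "monom a \<in> add_multiples J (monom c) UNIV" if "a = c \<or> monom a \<in> J" for a
            using that subset_add_multiples[OF is_ideal_UNIV, of J "monom c"]
              add_multiplesI[of 0 J 1 UNIV "monom c" "monom c"] ideals(2)
            by (auto simp: ring_module.subspace_0)
          then have "N \<subseteq> add_multiples J (monom c) UNIV"
            unfolding N_def using * by (intro ring_module.span_minimal) auto
          then show ?thesis using that by blast
        qed
        then obtain j x where "j \<in> J" "y = j + monom c * x" by (auto elim!: add_multiplesE)
        then show ?thesis by (intro bexI[of _ x]) auto
      qed
    qed
    ultimately show ?thesis
      by (rule weakly_regular_extension[OF ideals(1) is_ideal_monomial_ideal[OF N] ideals(2) JN NI])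
  qed
qed

section \<open>Depth and Stanley depth from the saturated coordinates\<close>

lemma elementary_symmetric_in_max_ideal:
  assumes "0 < k"
  shows "(elementary_symmetric k :: ('n::finite, 'k::field) mvpoly) \<in> max_ideal"
  unfolding elementary_symmetric_def
proof (rule ring_module.subspace_sum)
  show ideal: "is_ideal (max_ideal :: ('n, 'k) mvpoly set)" by (simp add: max_ideal_def)
  fix F :: "'n set" assume "F \<in> {F. card F = k}"
  then obtain i where "i \<in> F" using assms by fastforce
  then have "(prod variable F :: ('n, 'k) mvpoly) = variable i * prod variable (F - {i})" by (simp add: prod.remove)
  moreover have "(variable i :: ('n, 'k) mvpoly) \<in> max_ideal" by (simp add: max_ideal_def ring_module.span_base)
  ultimately show "(prod variable F :: ('n, 'k) mvpoly) \<in> max_ideal" by (metis ideal ideal_mult_right)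
qed

text \<open>
  Nakayama's lemma for graded modules: the products \<open>f * g\<close> with \<open>f\<close> in the maximal ideal and \<open>g\<close>
  in \<open>I\<close> cannot produce a monomial of least degree among those of \<open>I\<close> outside \<open>J\<close>.
\<close>

lemma multiples_in_quotient_neq:
  fixes I J :: "('n::finite, 'k::field) mvpoly set"
  assumes I: "monomial_ideal I" and J: "monomial_ideal J" and "J \<subset> I"
    and fs: "set fs \<subseteq> max_ideal"
  shows "multiples_in_quotient fs I J \<noteq> I"
proof -
  obtain a where "monom a \<in> I" "monom a \<notin> J" using monom_in_difference[OF I J] assms(3) by blast
  then obtain u where u: "monom u \<in> I" "monom u \<notin> J"
    and min: "\<And>a. monom a \<in> I \<Longrightarrow> monom a \<notin> J \<Longrightarrow> mdeg u \<le> mdeg a"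
    using ex_has_least_nat[of "\<lambda>a. monom a \<in> I \<and> monom a \<notin> J" _ mdeg] by blast
  let ?U = "{p \<in> I. u \<notin> Poly_Mapping.keys p}"
  have positive: "0 < mdeg a" if f: "f \<in> max_ideal" and a: "a \<in> Poly_Mapping.keys f"
    for f :: "('n, 'k) mvpoly" and a
  proof -
    let ?V = "{f :: ('n, 'k) mvpoly. \<forall>a \<in> Poly_Mapping.keys f. 0 < mdeg a}"
    have "is_ideal ?V"
      by (rule ring_module.subspaceI) (auto simp: mdeg_add elim!: keys_multE dest!: keys_addE)
    moreover have "range variable \<subseteq> ?V"
      by (auto simp: variable_def mdeg_def lookup_single when_def)
    ultimately have "max_ideal \<subseteq> ?V" unfolding max_ideal_def by (intro ring_module.span_minimal)
    then show ?thesis using f a by blast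
  qed
  have minimal: "mdeg a = 0" if u_eq: "u = a + b" and b: "monom b \<in> I" for a b
  proof -
    have "monom b \<notin> J"
      using u(2) monom_in_monomial_ideal_mono[OF J, of b u] by (auto simp: u_eq lookup_add)
    then have "mdeg u \<le> mdeg b" using min b by blast
    then show ?thesis by (simp add: u_eq mdeg_add)
  qed
  have "is_ideal ?U"
  proof (rule ring_module.subspaceI)
    fix c x assume x: "x \<in> ?U"
    have "u \<notin> Poly_Mapping.keys (c * x)"
    proof
      assume "u \<in> Poly_Mapping.keys (c * x)"
      then obtain a b where ab: "u = a + b" "b \<in> Poly_Mapping.keys x" by (auto elim!: keys_multE)
      then have "mdeg a = 0" using minimal x in_monomial_ideal_iff[OF I] by blast
      then have "a = 0" by (intro poly_mapping_eqI) (simp add: mdeg_def)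
      then show False using ab x by simp
    qed
    then show "c * x \<in> ?U" using x is_ideal_monomial_ideal[OF I] by (simp add: ideal_closed)
  qed (use is_ideal_monomial_ideal[OF I] in \<open>auto simp: ideal_closed dest!: keys_addE\<close>)
  moreover have "J \<subseteq> ?U"
    using \<open>J \<subset> I\<close> u(2) in_monomial_ideal_iff[OF J] by blast
  moreover have "f * g \<in> ?U" if "f \<in> set fs" "g \<in> I" for f g
  proof -
    have "u \<notin> Poly_Mapping.keys (f * g)"
    proof
      assume "u \<in> Poly_Mapping.keys (f * g)"
      then obtain a b where ab: "u = a + b" "a \<in> Poly_Mapping.keys f" "b \<in> Poly_Mapping.keys g"
        by (auto elim!: keys_multE)
      then have "mdeg a = 0" using minimal \<open>g \<in> I\<close> in_monomial_ideal_iff[OF I] by blast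
      moreover have "0 < mdeg a" using positive ab fs \<open>f \<in> set fs\<close> by blast
      ultimately show False by simp
    qed
    then show ?thesis using \<open>g \<in> I\<close> is_ideal_monomial_ideal[OF I] by (simp add: ideal_closed)
  qed
  ultimately have "multiples_in_quotient fs I J \<subseteq> ?U"
    unfolding multiples_in_quotient_def by (intro ring_module.span_minimal) auto
  moreover have "monom u \<notin> ?U" by simp
  ultimately show ?thesis using u(1) by blast
qed


lemma depth_ge:
  fixes I J :: "('n::finite, 'k::field) mvpoly set"
  assumes I: "monomial_ideal I" "exponents_matter_up_to M I"
    and J: "monomial_ideal J" "exponents_matter_up_to M J" and "J \<subset> I"
    and card: "\<And>c. c \<in> capped_monomials M I J \<Longrightarrow> t \<le> card (maxed M c)"
  shows "enat t \<le> depth I J"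
proof -
  let ?fs = "map elementary_symmetric (rev [1..<Suc t]) :: ('n, 'k) mvpoly list"
  have max: "set ?fs \<subseteq> max_ideal"
    by (auto simp: Suc_le_eq intro!: elementary_symmetric_in_max_ideal)
  have "weakly_regular ?fs I J"
    using \<open>J \<subset> I\<close> card
    by (intro weakly_regular_by_capped_monomials[OF I J] weakly_regular_elementary_symmetric) auto
  then have "regular_sequence ?fs I J"
    using multiples_in_quotient_neq[OF I(1) J(1) \<open>J \<subset> I\<close> max]
    by (simp add: regular_sequence_iff is_ideal_monomial_ideal I J)
  then have "enat (length ?fs) \<in> {enat (length fs) | fs. set fs \<subseteq> max_ideal \<and> regular_sequence fs I J}"
    using max by blast
  then have "enat (length ?fs) \<le> depth I J" unfolding depth_def by (rule Sup_upper)
  then show ?thesis by (simp del: upt_Suc)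
qed

lemma polys_in_add: "p \<in> polys_in Z \<Longrightarrow> q \<in> polys_in Z \<Longrightarrow> p + q \<in> polys_in Z"
  unfolding polys_in_def by (blast dest: keys_addE)

text \<open>
  The monomials in \<open>x^c K[maxed M c]\<close> are exactly those whose capped form is \<open>c\<close>. So the spaces are
  disjoint in terms of monomials, which gives directness, and they reach every monomial of \<open>I\<close>
  outside \<open>J\<close>.
\<close>

lemma stanley_decomposition_capped:
  fixes I J :: "('n::finite, 'k::field) mvpoly set"
  assumes I: "monomial_ideal I" "exponents_matter_up_to M I"
    and J: "monomial_ideal J" "exponents_matter_up_to M J"
    and cs: "distinct cs" "set cs = capped_monomials M I J"
  shows "stanley_decomposition I J (map (\<lambda>c. (maxed M c, monom c)) cs)"
proof -
  let ?D = "map (\<lambda>c. (maxed M c, monom c :: ('n, 'k) mvpoly)) cs"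
  let ?good = "\<lambda>p. \<forall>l<length cs. p l \<in> (polys_in (maxed M (cs ! l)) :: ('n, 'k) mvpoly set)"
  note ideals = is_ideal_monomial_ideal[OF I(1)] is_ideal_monomial_ideal[OF J(1)]
  have in_C: "cap M c = c" "monom c \<in> I" "monom c \<notin> J" if "c \<in> set cs" for c
    using that unfolding cs by (auto simp: capped_monomials_def)
  have keys_piece: "cap M a = c \<and> monom a \<notin> J"
    if "c \<in> set cs" "p \<in> polys_in (maxed M c)" "a \<in> Poly_Mapping.keys (monom c * p)"
    for a c and p :: "('n, 'k) mvpoly"
  proof -
    from that obtain b where b: "b \<in> Poly_Mapping.keys p" "a = c + b"
      by (auto simp: keys_monom_mult)
    then have "cap M a = c" using cap_add_maxed[OF in_C(1)[OF that(1)]] that b by (auto simp: polys_in_def)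
    then show ?thesis using in_C that J(2) by (metis exponents_matter_up_to_def)
  qed
  have "p = 0" if "c \<in> set cs" "p \<in> polys_in (maxed M c)" "p * monom c \<in> J" for c p
  proof -
    have "Poly_Mapping.keys (monom c * p) = {}"
      using keys_piece[OF that(1,2)] that(3) in_monomial_ideal_iff[OF J(1)] by (metis all_not_in_conv mult.commute)
    then show ?thesis unfolding keys_monom_mult by simp
  qed
  moreover have "\<exists>p. ?good p \<and> f - (\<Sum>l<length cs. p l * monom (cs ! l)) \<in> J" if "f \<in> I" for f
  proof -
    \<comment> \<open>the representable polynomials form a vector space; it suffices to treat single terms\<close>
    define R where "R = {f. \<exists>p. ?good p \<and> f - (\<Sum>l<length cs. p l * monom (cs ! l)) \<in> J}"
    have R_J: "f \<in> R" if "f \<in> J" for f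
      unfolding R_def using that by (intro CollectI exI[of _ "\<lambda>_. 0"]) (simp add: polys_in_def)
    have R_add: "f + g \<in> R" if "f \<in> R" "g \<in> R" for f g
    proof -
      from that obtain p q where
        p: "?good p" "f - (\<Sum>l<length cs. p l * monom (cs ! l)) \<in> J" and
        q: "?good q" "g - (\<Sum>l<length cs. q l * monom (cs ! l)) \<in> J"
        unfolding R_def by blast
      have "?good (\<lambda>l. p l + q l)" using p(1) q(1) by (simp add: polys_in_add)
      moreover have "f + g - (\<Sum>l<length cs. (p l + q l) * monom (cs ! l)) \<in> J"
        using ring_module.subspace_add[OF ideals(2) p(2) q(2)]
        by (simp add: algebra_simps sum.distrib)
      ultimately show ?thesis unfolding R_def by (intro CollectI exI[of _ "\<lambda>l. p l + q l"] conjI)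
    qed
    have R_single: "Poly_Mapping.single a v \<in> R" if a: "monom a \<in> I" for a v
    proof (cases "monom a \<in> J")
      case True
      then show ?thesis
        by (intro R_J) (subst single_eq_scaled_monom, rule ring_module.subspace_scale[OF ideals(2)])
    next
      case False
      then have "cap M a \<in> set cs" unfolding cs using a cap_in_capped_monomials I J by blast
      then obtain l where l: "l < length cs" "cs ! l = cap M a" by (auto simp: in_set_conv_nth)
      have "\<exists>b. a = cap M a + b" unfolding multiple_iff by simp
      then obtain b where b: "a = cap M a + b" ..
      have "i \<in> maxed M (cap M a)" if i: "i \<in> Poly_Mapping.keys b" for i
      proof -
        have "Poly_Mapping.lookup a i = min (Poly_Mapping.lookup a i) (M i) + Poly_Mapping.lookup b i"
          by (subst b) (simp add: lookup_add)
        then show ?thesis using i by (simp add: maxed_def in_keys_iff)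
      qed
      then have good: "?good ((\<lambda>_. 0)(l := Poly_Mapping.single b v))"
        using l by (auto simp: polys_in_def)
      have "(\<Sum>m<length cs. ((\<lambda>_. 0)(l := Poly_Mapping.single b v)) m * monom (cs ! m))
          = (\<Sum>m<length cs. if m = l then Poly_Mapping.single b v * monom (cs ! m) else 0)"
        by (intro sum.cong) auto
      also have "\<dots> = Poly_Mapping.single a v"
        using l b by (simp add: monom_def mult_single add.commute)
      finally have "Poly_Mapping.single a v
          - (\<Sum>m<length cs. ((\<lambda>_. 0)(l := Poly_Mapping.single b v)) m * monom (cs ! m)) \<in> J"
        using ideals(2) by (simp add: ring_module.subspace_0)
      then show ?thesis
        unfolding R_def using good
        by (intro CollectI exI[of _ "(\<lambda>_. 0)(l := Poly_Mapping.single b v)"] conjI)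
    qed
    have "(\<Sum>a\<in>A. Poly_Mapping.single a (Poly_Mapping.lookup f a)) \<in> R"
      if "finite A" "A \<subseteq> Poly_Mapping.keys f" for A
      using that
    proof (induction A rule: finite_induct)
      case empty
      then show ?case using R_J ideals(2) by (simp add: ring_module.subspace_0)
    next
      case (insert a A)
      have "monom a \<in> I" using in_monomial_ideal_iff[OF I(1), of f] \<open>f \<in> I\<close> insert.prems by blast
      then show ?case using insert by (simp add: R_add R_single)
    qed
    then have "f \<in> R" using poly_expansion[of f] finite_keys[of f] by (metis order_refl)
    then show ?thesis unfolding R_def by blast
  qed
  moreover have "p l * monom (cs ! l) \<in> J"
    if p: "?good p" and sum: "(\<Sum>l<length cs. p l * monom (cs ! l)) \<in> J" and l: "l < length cs" for p l
  proof -
    have "Poly_Mapping.keys (p l * monom (cs ! l)) = {}"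
    proof (rule ccontr)
      assume "Poly_Mapping.keys (p l * monom (cs ! l)) \<noteq> {}"
      then obtain a where a: "a \<in> Poly_Mapping.keys (p l * monom (cs ! l))" by blast
      then have cap_a: "cap M a = cs ! l" "monom a \<notin> J"
        using keys_piece[of "cs ! l" "p l" a] p l by (auto simp: mult.commute)
      have "Poly_Mapping.lookup (p m * monom (cs ! m)) a = 0" if m: "m < length cs" "m \<noteq> l" for m
      proof -
        have "cs ! m \<noteq> cs ! l" using cs(1) m l by (simp add: nth_eq_iff_index_eq)
        then have "a \<notin> Poly_Mapping.keys (p m * monom (cs ! m))"
          using keys_piece[of "cs ! m" "p m" a] p m cap_a by (auto simp: mult.commute)
        then show ?thesis by (simp add: in_keys_iff)
      qed
      then have "Poly_Mapping.lookup (\<Sum>m<length cs. p m * monom (cs ! m)) a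
          = (\<Sum>m<length cs. if m = l then Poly_Mapping.lookup (p l * monom (cs ! l)) a else 0)"
        unfolding lookup_sum by (intro sum.cong) auto
      then have "a \<in> Poly_Mapping.keys (\<Sum>m<length cs. p m * monom (cs ! m))"
        using a l by (simp add: in_keys_iff)
      then show False using sum cap_a in_monomial_ideal_iff[OF J(1)] by blast
    qed
    then show ?thesis using ideals(2) by (simp add: ring_module.subspace_0)
  qed
  moreover have "\<exists>a v. (monom c :: ('n, 'k) mvpoly) = Poly_Mapping.single a v" for c
    by (auto simp: monom_def)
  ultimately show ?thesis
    using in_C by (simp add: stanley_decomposition_def)
qed

text \<open>
  The maximum in the definition of \<open>sdepth\<close> is taken over a finite set, bounded by the number of
  variables or by the arbitrary value \<open>Min {}\<close> of the empty decomposition.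
\<close>

lemma sdepth_ge:
  fixes I J :: "('n::finite, 'k::field) mvpoly set"
  assumes I: "monomial_ideal I" "exponents_matter_up_to M I"
    and J: "monomial_ideal J" "exponents_matter_up_to M J" and "J \<subset> I"
    and card: "\<And>c. c \<in> capped_monomials M I J \<Longrightarrow> t \<le> card (maxed M c)"
  shows "t \<le> sdepth I J"
proof -
  obtain cs where cs: "distinct cs" "set cs = capped_monomials M I J"
    using finite_distinct_list[OF finite_capped_monomials] by metis
  let ?D = "map (\<lambda>c. (maxed M c, monom c :: ('n, 'k) mvpoly)) cs"
  let ?S = "{sdepth_of_decomposition D | D. stanley_decomposition I J D}"
  have "sdepth_of_decomposition D \<le> max (Min {}) (card (UNIV :: 'n set))"
    for D :: "('n set \<times> ('n, 'k) mvpoly) list"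
  proof (cases "D = []")
    case True
    then show ?thesis by (simp add: sdepth_of_decomposition_def)
  next
    case False
    then have "sdepth_of_decomposition D \<in> (\<lambda>(Z, u). card Z) ` set D"
      unfolding sdepth_of_decomposition_def by (intro Min_in) auto
    then have "sdepth_of_decomposition D \<le> card (UNIV :: 'n set)" by (auto intro!: card_mono)
    then show ?thesis by simp
  qed
  then have "finite ?S" by (intro finite_subset[of ?S "{..max (Min {}) (card (UNIV :: 'n set))}"]) auto
  then have "sdepth_of_decomposition ?D \<le> sdepth I J"
    unfolding sdepth_def using stanley_decomposition_capped[OF I J cs] by (intro Max_ge) auto
  moreover have "\<not> I \<subseteq> J" using \<open>J \<subset> I\<close> by blast
  then have "cs \<noteq> []"
    using capped_monomials_nonempty[OF I(1) J(1) _ I(2) J(2)] cs by fastforce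
  then have "t \<le> sdepth_of_decomposition ?D"
    unfolding sdepth_of_decomposition_def using card cs
    by (subst Min_ge_iff) (auto simp: finite_capped_monomials)
  ultimately show ?thesis by simp
qed

section \<open>Finiteness of the minimal generating set\<close>

lemma nondecreasing_subsequence:
  fixes s :: "nat \<Rightarrow> nat"
  shows "\<exists>r::nat \<Rightarrow> nat. strict_mono r \<and> mono (\<lambda>k. s (r k))"
proof -
  obtain r :: "nat \<Rightarrow> nat" where r: "strict_mono r" "monoseq (\<lambda>k. s (r k))" using seq_monosub by blast
  show ?thesis
  proof (cases "mono (\<lambda>k. s (r k))")
    case True
    then show ?thesis using r(1) by (intro exI[of _ r] conjI)
  next
    case False
    then have decreasing: "\<And>m n. m \<le> n \<Longrightarrow> s (r n) \<le> s (r m)"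
      using r(2) unfolding monoseq_def mono_def by blast
    obtain m where m: "\<And>k. s (r m) \<le> s (r k)"
      using ex_has_least_nat[of "\<lambda>_. True" _ "\<lambda>k. s (r k)"] by blast
    \<comment> \<open>a nonincreasing sequence is constant from its minimum on\<close>
    have "s (r (m + k)) = s (r m)" for k
      using decreasing[of m "m + k"] m[of "m + k"] by simp
    then have "mono (\<lambda>k. s (r (m + k)))" by (simp add: mono_def)
    moreover have "strict_mono (\<lambda>k. r (m + k))" using r(1) by (simp add: strict_mono_def)
    ultimately show ?thesis by (intro exI[of _ "\<lambda>k. r (m + k)"] conjI)
  qed
qed

lemma common_nondecreasing_subsequence:
  fixes s :: "nat \<Rightarrow> 'i \<Rightarrow> nat"
  assumes "finite X"
  shows "\<exists>r::nat \<Rightarrow> nat. strict_mono r \<and> (\<forall>i\<in>X. mono (\<lambda>k. s (r k) i))"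
  using assms
proof (induction X rule: finite_induct)
  case empty
  show ?case by (rule exI[of _ "\<lambda>k. k"]) (simp add: strict_mono_def)
next
  case (insert i X)
  then obtain r :: "nat \<Rightarrow> nat" where r: "strict_mono r" "\<forall>j\<in>X. mono (\<lambda>k. s (r k) j)" by blast
  obtain q :: "nat \<Rightarrow> nat" where q: "strict_mono q" "mono (\<lambda>k. s (r (q k)) i)"
    using nondecreasing_subsequence[of "\<lambda>k. s (r k) i"] by blast
  have "mono (\<lambda>k. s (r (q k)) j)" if "j \<in> X" for j
    using r(2) that strict_mono_mono[OF q(1)] unfolding mono_def by blast
  moreover have "strict_mono (\<lambda>k. r (q k))" using r(1) q(1) by (simp add: strict_mono_def)
  ultimately show ?case using q(2) by (intro exI[of _ "\<lambda>k. r (q k)"]) auto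
qed

text \<open>
  Dickson's lemma. An infinite sequence of distinct minimal generators would have a subsequence
  along which every exponent is nondecreasing, and then one generator would divide another.
\<close>

lemma finite_min_gens:
  fixes I :: "('n::finite, 'k::field) mvpoly set"
  assumes "monomial_ideal I"
  shows "finite (min_gens I)"
proof (rule ccontr)
  assume "infinite (min_gens I)"
  then obtain s :: "nat \<Rightarrow> 'n monomial" where s: "inj s" "range s \<subseteq> min_gens I"
    using infinite_countable_subset by blast
  obtain r :: "nat \<Rightarrow> nat" where r: "strict_mono r" "\<And>i. mono (\<lambda>k. Poly_Mapping.lookup (s (r k)) i)"
    using common_nondecreasing_subsequence[of UNIV "\<lambda>k. Poly_Mapping.lookup (s k)"] by auto
  have "\<forall>i. Poly_Mapping.lookup (s (r 0)) i \<le> Poly_Mapping.lookup (s (r 1)) i"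
    using r(2) by (auto simp: mono_def)
  then obtain c where "s (r 1) = s (r 0) + c" using multiple_iff by blast
  moreover have "s (r 0) \<in> min_gens I" "s (r 1) \<in> min_gens I" using s by auto
  ultimately have "s (r 0) = s (r 1)" unfolding min_gens_eq[OF assms] by blast
  then have "r 0 = r 1" using s(1) by (simp add: inj_eq)
  then show False using r(1) by (simp add: strict_mono_eq)
qed

lemma ideal_span_min_gens:
  fixes I :: "('n::finite, 'k::field) mvpoly set"
  assumes "monomial_ideal I"
  shows "ideal_span (monom ` min_gens I) = I"
  using is_minimal_generating_set_iff[OF assms] min_gens_eq[OF assms]
  by (metis is_minimal_generating_set_def)

lemma monom_in_iff_min_gens:
  fixes I :: "('n::finite, 'k::field) mvpoly set"
  assumes "monomial_ideal I"
  shows "monom a \<in> I \<longleftrightarrow>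
    (\<exists>g\<in>min_gens I. \<forall>i. Poly_Mapping.lookup g i \<le> Poly_Mapping.lookup a i)"
proof -
  have "monom a \<in> I \<longleftrightarrow> monom a \<in> (ideal_span (monom ` min_gens I) :: ('n, 'k) mvpoly set)"
    by (simp only: ideal_span_min_gens[OF assms])
  then show ?thesis by (simp add: monom_in_ideal_span_iff multiple_iff)
qed

lemma min_gens_antichain:
  fixes I :: "('n::finite, 'k::field) mvpoly set"
  assumes "monomial_ideal I" "g \<in> min_gens I" "h \<in> min_gens I"
    and "\<forall>i. Poly_Mapping.lookup g i \<le> Poly_Mapping.lookup h i"
  shows "g = h"
  using assms(2-) unfolding multiple_iff[symmetric] min_gens_eq[OF assms(1)] by blast

lemma min_gens_ideal_span_antichain:
  fixes A :: "'n::finite monomial set"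
  assumes "\<And>g h. g \<in> A \<Longrightarrow> h \<in> A \<Longrightarrow> \<forall>i. Poly_Mapping.lookup g i \<le> Poly_Mapping.lookup h i \<Longrightarrow> g = h"
  shows "min_gens (ideal_span (monom ` A) :: ('n, 'k::field) mvpoly set) = A"
proof -
  let ?I = "ideal_span (monom ` A) :: ('n, 'k) mvpoly set"
  have "monomial_ideal ?I" by (auto simp: monomial_ideal_def)
  note eq = min_gens_eq[OF this, unfolded monom_in_ideal_span_iff]
  have "a \<in> min_gens ?I" if a: "a \<in> A" for a
    unfolding eq
  proof (intro CollectI conjI allI impI)
    show "\<exists>b\<in>A. \<exists>c. a = b + c" using a by (intro bexI[of _ a] exI[of _ 0]) auto
    fix b c assume *: "(\<exists>a\<in>A. \<exists>c. b = a + c) \<and> a = b + c"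
    then obtain g d where g: "g \<in> A" "b = g + d" by blast
    then have "g = a" using * by (intro assms a) (auto simp: lookup_add)
    then have "d + c = 0" using * g by (simp add: add.assoc)
    then have "c = 0"
      by (intro poly_mapping_eqI) (metis lookup_add lookup_zero add_is_0)
    then show "b = a" using * by simp
  qed
  moreover have "a \<in> A" if a: "a \<in> min_gens ?I" for a
  proof -
    obtain b c where b: "b \<in> A" "a = b + c" using a unfolding eq by blast
    moreover have "\<exists>a\<in>A. \<exists>c. b = a + c" using b by (intro bexI[of _ b] exI[of _ 0]) auto
    ultimately have "b = a" using a unfolding eq by blast
    then show ?thesis using b by simp
  qed
  ultimately show ?thesis by blast
qed

section \<open>The canonical form\<close>

lemma exponent_rank_mono: "finite E \<Longrightarrow> k \<le> l \<Longrightarrow> exponent_rank E k \<le> exponent_rank E l"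
  unfolding exponent_rank_def by (rule card_mono) auto

text \<open>
  Exponents from an element of \<open>E\<close> up to the next one have equal rank. So ranks decide
  \<open>k \<le> l\<close> for an element \<open>k\<close> of \<open>E\<close>, that is, in the applications, for an exponent \<open>k\<close>
  of a generator.
\<close>

lemma exponent_rank_le_iff:
  assumes "finite E" "k \<in> E"
  shows "exponent_rank E k \<le> exponent_rank E l \<longleftrightarrow> k \<le> l"
proof
  assume *: "exponent_rank E k \<le> exponent_rank E l"
  show "k \<le> l"
  proof (rule ccontr)
    assume "\<not> k \<le> l"
    moreover have "k \<in> {m \<in> E. 0 < m \<and> m \<le> k} - {m \<in> E. 0 < m \<and> m \<le> l}"
      using assms(2) \<open>\<not> k \<le> l\<close> by simp
    moreover have "{m \<in> E. 0 < m \<and> m \<le> l} \<subseteq> {m \<in> E. 0 < m \<and> m \<le> k}"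
      using \<open>\<not> k \<le> l\<close> by force
    ultimately have "{m \<in> E. 0 < m \<and> m \<le> l} \<subset> {m \<in> E. 0 < m \<and> m \<le> k}" by blast
    then have "exponent_rank E l < exponent_rank E k"
      unfolding exponent_rank_def using assms(1) by (intro psubset_card_mono) auto
    then show False using * by simp
  qed
qed (use assms exponent_rank_mono in blast)

lemma lookup_compress:
  "Poly_Mapping.lookup (compress i E u) j
    = (if j = i then exponent_rank E (Poly_Mapping.lookup u j) else Poly_Mapping.lookup u j)"
  by (auto simp: compress_def lookup_update)

text \<open>
  Compression embeds the order of the exponents that occur, so the compressed generators still form
  an antichain under divisibility, and no generator becomes redundant.
\<close>

lemma min_gens_compress:
  fixes I :: "('n::finite, 'k::field) mvpoly set"
  assumes I: "monomial_ideal I" and E: "finite E" "\<And>g. g \<in> min_gens I \<Longrightarrow> Poly_Mapping.lookup g i \<in> E"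
  shows "min_gens (ideal_span (monom ` compress i E ` min_gens I) :: ('n, 'k) mvpoly set)
    = compress i E ` min_gens I"
proof (rule min_gens_ideal_span_antichain)
  fix g h assume "g \<in> compress i E ` min_gens I" "h \<in> compress i E ` min_gens I"
    and le: "\<forall>j. Poly_Mapping.lookup g j \<le> Poly_Mapping.lookup h j"
  then obtain g' h' where *: "g' \<in> min_gens I" "h' \<in> min_gens I" "g = compress i E g'" "h = compress i E h'"
    by blast
  have "Poly_Mapping.lookup g' j \<le> Poly_Mapping.lookup h' j" for j
    using le[rule_format, of j] E * by (auto simp: lookup_compress exponent_rank_le_iff split: if_splits)
  then show "g = h" using min_gens_antichain[OF I *(1,2)] * by simp
qed

lemma monom_compress_in:
  fixes I :: "('n::finite, 'k::field) mvpoly set"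
  assumes I: "monomial_ideal I" and E: "finite E" and "monom a \<in> I"
  shows "monom (compress i E a) \<in> (ideal_span (monom ` compress i E ` min_gens I) :: ('n, 'k) mvpoly set)"
proof -
  obtain g where "g \<in> min_gens I" "\<forall>j. Poly_Mapping.lookup g j \<le> Poly_Mapping.lookup a j"
    using assms monom_in_iff_min_gens[OF I] by blast
  then have "\<forall>j. Poly_Mapping.lookup (compress i E g) j \<le> Poly_Mapping.lookup (compress i E a) j"
    using exponent_rank_mono[OF E] by (auto simp: lookup_compress)
  then show ?thesis
    unfolding monom_in_ideal_span_iff multiple_iff using \<open>g \<in> min_gens I\<close> by blast
qed

definition nonzero_monomial_pair :: "('n::finite, 'k::field) mvpoly set \<times> ('n, 'k) mvpoly set \<Rightarrow> bool" where
  "nonzero_monomial_pair P \<longleftrightarrow> monomial_ideal (fst P) \<and> monomial_ideal (snd P) \<and> min_gens (fst P) \<noteq> {}"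

lemma finite_exponents_of:
  "nonzero_monomial_pair (I, J) \<Longrightarrow> finite (exponents_of i I J)" "nonzero_monomial_pair (I, J) \<Longrightarrow> exponents_of i I J \<noteq> {}"
  by (auto simp: nonzero_monomial_pair_def exponents_of_def finite_min_gens)

text \<open>
  The witness \<open>b\<close> is the compressed \<open>a\<close>. The largest exponent in the direction \<open>i\<close> is compressed along
  with it, and the other directions do not change, so it is maximal in the same variables.
\<close>

lemma canonical_form_wrt_step:
  fixes I J :: "('n::finite, 'k::field) mvpoly set"
  assumes nonzero: "nonzero_monomial_pair (I, J)" and step: "canonical_form_wrt i (I, J) = (I', J')"
    and a: "monom a \<in> I" "\<And>j. Poly_Mapping.lookup a j \<le> max_exponent j I J"
  shows "nonzero_monomial_pair (I', J') \<and> (\<exists>b. monom b \<in> I' \<and>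
    (\<forall>j. Poly_Mapping.lookup b j \<le> max_exponent j I' J') \<and>
    maxed (\<lambda>j. max_exponent j I' J') b = maxed (\<lambda>j. max_exponent j I J) a)"
proof -
  define E where "E = exponents_of i I J"
  have I: "monomial_ideal I" and J: "monomial_ideal J" using nonzero by (auto simp: nonzero_monomial_pair_def)
  have E: "finite E" "E \<noteq> {}" unfolding E_def using finite_exponents_of[OF nonzero] by auto
  have I': "I' = ideal_span (monom ` compress i E ` min_gens I)"
    and J': "J' = ideal_span (monom ` compress i E ` min_gens J)"
    using step by (auto simp: canonical_form_wrt_def E_def Let_def)
  have gens: "min_gens I' = compress i E ` min_gens I" "min_gens J' = compress i E ` min_gens J"
    unfolding I' J' using E(1)
    by (intro min_gens_compress I J; auto simp: E_def exponents_of_def)+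
  have "monomial_ideal I'" "monomial_ideal J'" unfolding I' J' monomial_ideal_def by blast+
  then have nonzero': "nonzero_monomial_pair (I', J')" using nonzero by (simp add: nonzero_monomial_pair_def gens)
  have "exponents_of j I' J' = (if j = i then exponent_rank E ` E else exponents_of j I J)" for j
    by (simp add: exponents_of_def gens image_image lookup_compress E_def flip: image_Un)
  moreover have "Max (exponent_rank E ` E) = exponent_rank E (Max E)"
    using E exponent_rank_mono[OF E(1)] by (intro mono_Max_commute[symmetric] monoI) auto
  ultimately have max': "max_exponent j I' J'
      = (if j = i then exponent_rank E (max_exponent j I J) else max_exponent j I J)" for j
    by (simp add: max_exponent_def E_def)
  have "max_exponent i I J \<in> E" unfolding max_exponent_def E_def[symmetric] using E by (rule Max_in)
  then have "maxed (\<lambda>j. max_exponent j I' J') (compress i E a) = maxed (\<lambda>j. max_exponent j I J) a"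
    using E(1) by (auto simp: maxed_def max' lookup_compress exponent_rank_le_iff)
  moreover have "\<forall>j. Poly_Mapping.lookup (compress i E a) j \<le> max_exponent j I' J'"
    using a(2) exponent_rank_mono[OF E(1)] by (auto simp: max' lookup_compress)
  moreover have "monom (compress i E a) \<in> I'" unfolding I' using monom_compress_in[OF I E(1) a(1)] .
  ultimately show ?thesis using nonzero' by blast
qed

lemma initial_degree_le_maxed:
  fixes I J :: "('n::finite, 'k::field) mvpoly set"
  assumes nonzero: "nonzero_monomial_pair (I, J)"
    and a: "monom a \<in> I" "\<And>j. Poly_Mapping.lookup a j \<le> max_exponent j I J"
  shows "initial_degree I J \<le> excess I J + card (maxed (\<lambda>j. max_exponent j I J) a)"
proof -
  let ?M = "\<lambda>j. max_exponent j I J"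
  have I: "monomial_ideal I" using nonzero by (simp add: nonzero_monomial_pair_def)
  obtain g where g: "g \<in> min_gens I" "\<forall>j. Poly_Mapping.lookup g j \<le> Poly_Mapping.lookup a j"
    using a monom_in_iff_min_gens[OF I] by blast
  have "initial_degree I J \<le> mdeg g"
    unfolding initial_degree_def using g finite_min_gens[OF I] by (intro Min_le) auto
  also have "mdeg g \<le> mdeg a" unfolding mdeg_def using g by (intro sum_mono) auto
  \<comment> \<open>the variables of exponent \<open>0\<close> throughout are maximal as well: the bound for them is \<open>1\<close>\<close>
  also have "mdeg a \<le> (\<Sum>j\<in>UNIV. (if 0 < ?M j then ?M j - 1 else 0) + (if j \<in> maxed ?M a then 1 else 0))"
    unfolding mdeg_def
  proof (rule sum_mono)
    fix j show "Poly_Mapping.lookup a j \<le> (if 0 < ?M j then ?M j - 1 else 0) + (if j \<in> maxed ?M a then 1 else 0)"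
      using a(2)[of j] by (auto simp: maxed_def)
  qed
  also have "\<dots> = excess I J + card (maxed ?M a)"
    by (simp add: sum.distrib excess_def sum.If_cases)
  finally show ?thesis .
qed

text \<open>
  One compression step preserves the situation, and so does the composition of all of them; in the
  resulting canonical form the degree count applies.
\<close>

lemma index_le_card_maxed:
  fixes I J :: "('n::{finite,linorder}, 'k::field) mvpoly set"
  assumes "nonzero_monomial_pair (I, J)"
    and "monom a \<in> I" "\<And>j. Poly_Mapping.lookup a j \<le> max_exponent j I J"
  shows "index I J \<le> card (maxed (\<lambda>j. max_exponent j I J) a)"
proof -
  have fold: "nonzero_monomial_pair (I', J') \<and> (\<exists>b. monom b \<in> I' \<and>
      (\<forall>j. Poly_Mapping.lookup b j \<le> max_exponent j I' J') \<and>
      maxed (\<lambda>j. max_exponent j I' J') b = maxed (\<lambda>j. max_exponent j I J) a)"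
    if "nonzero_monomial_pair (I, J)" "monom a \<in> I" "\<And>j. Poly_Mapping.lookup a j \<le> max_exponent j I J"
      "fold canonical_form_wrt xs (I, J) = (I', J')"
    for xs :: "'n list" and I J I' J' :: "('n, 'k) mvpoly set" and a
    using that
  proof (induction xs arbitrary: I J a)
    case Nil
    then show ?case by auto
  next
    case (Cons i xs)
    obtain I1 J1 where IJ1: "canonical_form_wrt i (I, J) = (I1, J1)" by fastforce
    from canonical_form_wrt_step[OF Cons.prems(1) IJ1 Cons.prems(2,3)]
    obtain b where b: "nonzero_monomial_pair (I1, J1)" "monom b \<in> I1"
      "\<And>j. Poly_Mapping.lookup b j \<le> max_exponent j I1 J1"
      "maxed (\<lambda>j. max_exponent j I1 J1) b = maxed (\<lambda>j. max_exponent j I J) a" by blast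
    have "fold canonical_form_wrt xs (I1, J1) = (I', J')" using Cons.prems(4) IJ1 by simp
    from Cons.IH[OF b(1-3) this] show ?case unfolding b(4) .
  qed
  obtain I' J' where IJ': "canonical_form (I, J) = (I', J')" by fastforce
  from fold[OF assms IJ'[unfolded canonical_form_def]]
  obtain b where b: "nonzero_monomial_pair (I', J')" "monom b \<in> I'"
    "\<And>j. Poly_Mapping.lookup b j \<le> max_exponent j I' J'"
    "maxed (\<lambda>j. max_exponent j I' J') b = maxed (\<lambda>j. max_exponent j I J) a" by blast
  show ?thesis
    using initial_degree_le_maxed[OF b(1-3)] by (simp add: index_def IJ' b(4))
qed

lemma exponents_matter_up_to_max_exponent:
  fixes I :: "('n::finite, 'k::field) mvpoly set"
  assumes I: "monomial_ideal I"
    and M: "\<And>g j. g \<in> min_gens I \<Longrightarrow> Poly_Mapping.lookup g j \<le> M j"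
  shows "exponents_matter_up_to M I"
  unfolding exponents_matter_up_to_def monom_in_iff_min_gens[OF I] using M by auto

theorem proposition2:
  fixes I J :: "('n::{finite,linorder}, 'k::field) mvpoly set"
  assumes "monomial_ideal I" and "monomial_ideal J" and "J \<subset> I"
  shows "depth I J \<ge> enat (index I J) \<and> sdepth I J \<ge> index I J"
proof -
  note I = assms(1) and J = assms(2)
  let ?M = "\<lambda>j. max_exponent j I J"
  obtain a where "monom a \<in> I" using monom_in_difference[OF I J] assms(3) by blast
  then have "min_gens I \<noteq> {}" using monom_in_iff_min_gens[OF I] by blast
  then have nonzero: "nonzero_monomial_pair (I, J)" using I J by (simp add: nonzero_monomial_pair_def)
  have "Poly_Mapping.lookup g j \<le> ?M j" if "g \<in> min_gens I \<union> min_gens J" for g j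
    unfolding max_exponent_def using finite_exponents_of(1)[OF nonzero, of j] that
    by (intro Max_ge) (auto simp: exponents_of_def)
  then have M: "exponents_matter_up_to ?M I" "exponents_matter_up_to ?M J"
    by (auto intro!: exponents_matter_up_to_max_exponent I J)
  have "index I J \<le> card (maxed ?M c)" if "c \<in> capped_monomials ?M I J" for c
  proof (rule index_le_card_maxed[OF nonzero])
    show "monom c \<in> I" using that by (simp add: capped_monomials_def)
    show "Poly_Mapping.lookup c j \<le> ?M j" for j using that by (rule lookup_capped_monomial_le)
  qed
  then show ?thesis
    using depth_ge[OF I M(1) J M(2) assms(3)] sdepth_ge[OF I M(1) J M(2) assms(3)] by blast
qed

end
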